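(* Let $K$ be a field containing $\mathbb{Q}_p$, complete with respect to a non-Archimedean absolute value $|\cdot|$ with $|p|=1/p$, let $\mathfrak{o}$ be its valuation ring, and let $R$ be a subring of $\mathfrak{o}$ (with the topology induced by $|\cdot|$). If $\mathcal{M}$ is a finitely generated $K\langle x_1,\ldots,x_d,z\rangle$-module, then the set of $c\in R$ for which $\mathcal{M}|_{z=c}=(0)$ is open in $R$. If $R$ is compact, then there exists $\varepsilon>0$ such that, up to the addition and removal of finite sets, the set of $c\in R$ for which $\mathcal{M}|_{z=c}=(0)$ is a union of balls in $R$ of radius $\varepsilon$. In particular, if $R=\mathbb{Z}$, then up to addition and removal of finite sets, the set of $c\in\mathbb{Z}$ for which $\mathcal{M}|_{z=c}=(0)$ is a finite union of arithmetic progressions with difference $p^r$ for some $r\ge0$.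
   Context: $K\langle x_1,\ldots,x_d,z\rangle$ is the Tate algebra of power series over $K$ whose coefficients tend to $0$. For $c\in\mathfrak{o}$, $\mathcal{M}|_{z=c}$ denotes $\mathcal{M}/(z-c)\mathcal{M}$. *)

theory Defs
  imports "HOL-Algebra.Module" "HOL-Algebra.FiniteProduct" "HOL-Computational_Algebra.Primes" Complex_Main
begin

definition nonarch_abs :: "('k::field \<Rightarrow> real) \<Rightarrow> bool" where
  "nonarch_abs v \<longleftrightarrow>
     (\<forall>x. 0 \<le> v x) \<and> (\<forall>x. v x = 0 \<longleftrightarrow> x = 0) \<and>
     (\<forall>x y. v (x * y) = v x * v y) \<and>
     (\<forall>x y. v (x + y) \<le> max (v x) (v y))"

definition complete_wrt :: "('k::field \<Rightarrow> real) \<Rightarrow> bool" where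
  "complete_wrt v \<longleftrightarrow>
     (\<forall>s :: nat \<Rightarrow> 'k.
        (\<forall>e>0. \<exists>N. \<forall>m\<ge>N. \<forall>n\<ge>N. v (s m - s n) < e) \<longrightarrow>
        (\<exists>L. \<forall>e>0. \<exists>N. \<forall>n\<ge>N. v (s n - L) < e))"

definition val_ring :: "('k::field \<Rightarrow> real) \<Rightarrow> 'k set" where
  "val_ring v = {x. v x \<le> 1}"

definition is_subring :: "'k::field set \<Rightarrow> bool" where
  "is_subring R \<longleftrightarrow> 0 \<in> R \<and> 1 \<in> R \<and>
     (\<forall>x\<in>R. \<forall>y\<in>R. x + y \<in> R \<and> x * y \<in> R \<and> - x \<in> R)"

definition rel_open :: "('k::field \<Rightarrow> real) \<Rightarrow> 'k set \<Rightarrow> 'k set \<Rightarrow> bool" where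
  "rel_open v R S \<longleftrightarrow> S \<subseteq> R \<and>
     (\<forall>c\<in>S. \<exists>\<delta>>0. \<forall>c'\<in>R. v (c' - c) < \<delta> \<longrightarrow> c' \<in> S)"

definition rel_compact :: "('k::field \<Rightarrow> real) \<Rightarrow> 'k set \<Rightarrow> bool" where
  "rel_compact v R \<longleftrightarrow>
     (\<forall>\<U>. (\<forall>U\<in>\<U>. rel_open v R U) \<and> R \<subseteq> \<Union>\<U> \<longrightarrow>
        (\<exists>\<F>\<subseteq>\<U>. finite \<F> \<and> R \<subseteq> \<Union>\<F>))"

definition rel_ball :: "('k::field \<Rightarrow> real) \<Rightarrow> 'k set \<Rightarrow> 'k \<Rightarrow> real \<Rightarrow> 'k set" where
  "rel_ball v R a e = {c\<in>R. v (c - a) \<le> e}"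

text \<open>Monomials in d+1 variables: exponent vectors nat \<Rightarrow> nat supported in {0..d};
  variables 0..d-1 are x_1..x_d, variable d is z.\<close>
definition monomials :: "nat \<Rightarrow> (nat \<Rightarrow> nat) set" where
  "monomials d = {\<alpha>. \<forall>i>d. \<alpha> i = 0}"

type_synonym 'k tate = "(nat \<Rightarrow> nat) \<Rightarrow> 'k"

definition tate_carrier :: "('k::field \<Rightarrow> real) \<Rightarrow> nat \<Rightarrow> 'k tate set" where
  "tate_carrier v d = {f. (\<forall>\<alpha>. \<alpha> \<notin> monomials d \<longrightarrow> f \<alpha> = 0) \<and>
                         (\<forall>e>0. finite {\<alpha>. e \<le> v (f \<alpha>)})}"

definition tate_mult :: "'k::field tate \<Rightarrow> 'k tate \<Rightarrow> 'k tate" where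
  "tate_mult f g = (\<lambda>\<alpha>. \<Sum>\<beta>\<in>{\<beta>. \<forall>i. \<beta> i \<le> \<alpha> i}. f \<beta> * g (\<lambda>i. \<alpha> i - \<beta> i))"

definition tate_ring :: "('k::field \<Rightarrow> real) \<Rightarrow> nat \<Rightarrow> 'k tate ring" where
  "tate_ring v d = \<lparr> carrier = tate_carrier v d,
                     monoid.mult = tate_mult,
                     monoid.one = (\<lambda>\<alpha>. if \<alpha> = (\<lambda>i. 0) then 1 else 0),
                     zero = (\<lambda>\<alpha>. 0),
                     add = (\<lambda>f g \<alpha>. f \<alpha> + g \<alpha>) \<rparr>"

definition tate_z_minus :: "nat \<Rightarrow> 'k::field \<Rightarrow> 'k tate" where
  "tate_z_minus d c = (\<lambda>\<alpha>. (if \<alpha> = (\<lambda>i. if i = d then 1 else 0) then 1 else 0)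
                             - (if \<alpha> = (\<lambda>i. 0) then c else 0))"

definition fin_gen_module :: "'a ring \<Rightarrow> ('a, 'b) module \<Rightarrow> bool" where
  "fin_gen_module A M \<longleftrightarrow> Module.module A M \<and>
     (\<exists>(n::nat) g. (\<forall>i<n. g i \<in> carrier M) \<and>
        (\<forall>m\<in>carrier M. \<exists>a. (\<forall>i<n. a i \<in> carrier A) \<and>
            m = finsum M (\<lambda>i. a i \<odot>\<^bsub>M\<^esub> g i) {..<n}))"

text \<open>M|_{z=c} = M/(z-c)M is the zero module, i.e. M = (z-c)M.\<close>
definition specializes_to_zero :: "nat \<Rightarrow> ('k::field tate, 'b) module \<Rightarrow> 'k \<Rightarrow> bool" where
  "specializes_to_zero d M c \<longleftrightarrow>
     (\<forall>m\<in>carrier M. \<exists>m'\<in>carrier M. m = tate_z_minus d c \<odot>\<^bsub>M\<^esub> m')"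

end

(* By Nakayama's lemma, M/(z-c)M = 0 iff the annihilator I of M contains an element congruent to 1
   modulo z - c. Openness follows since 1 + h is a unit for |h| < 1.

   The global statements follow by compactness from a local dichotomy: near every a, either all
   c \<noteq> a are in the set, or none is. After moving a to 0, let J be the saturation of I with respect
   to the parameter y = z - a, and consider the leading monomials (maximal absolute value, then
   lexicographic order) of the series f(x,0) with f in J. If 1 is one of them, then J contains a
   unit on a small disc, and the fibres over c \<noteq> 0 vanish. Otherwise choose, by Dickson's lemma,
   finitely many members of J whose leading monomials generate all of them. On a small disc these
   allow division with remainder, and saturation makes a remainder in J vanish. If 1 = H + (y-c)U
   with H in J, replacing U by its remainder s gives (y-c)s = 1, which is impossible. *)

theory Submission
  imports Defs "HOL-Library.Function_Algebras"
begin

section \<open>Power series in countably many variables\<close>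

text \<open>The absolute value may have dense image, so there is no descent on the sizes of
  coefficients. Well-foundedness is asked only of the order on monomials; sizes are controlled by
  one factor \<open>\<theta>\<close> < 1. It exists because only finitely many terms of a series
  exceed a given bound and because Dickson's lemma leaves finitely many series to consider.

  The main obstacle is a mismatch of discs. Ideals live on the unit disc, but division by the chosen
  members of J works only after shrinking the radius of y, so a remainder is not literally an
  element of J. It is compared with J degree by degree in y: truncating the quotients in y brings
  them back to the unit disc, and saturation strips the power of y from the lowest term that
  survives.

  Saturation is also the reason why the centre is exempt when the nearby fibres vanish: an element
  of J gives one of I only after multiplication by some y^N, which is congruent to c^N modulo y - c
  and hence harmless for nonzero c.\<close>

definition finite_exp :: "(nat \<Rightarrow> nat) \<Rightarrow> bool" where
  "finite_exp \<alpha> \<longleftrightarrow> finite {i. \<alpha> i \<noteq> 0}"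

text \<open>Vanishing at exponents of infinite support keeps the convolution sums finite, so that
  all rings of convergent series become subrings of one \<open>comm_ring_1\<close> type.\<close>

typedef (overloaded) 'a mps = "{f :: (nat \<Rightarrow> nat) \<Rightarrow> 'a::zero. \<forall>\<alpha>. \<not> finite_exp \<alpha> \<longrightarrow> f \<alpha> = 0}"
  morphisms coeff Abs_mps
  by (rule exI[of _ "\<lambda>_. 0"]) auto

setup_lifting type_definition_mps

lemma coeff_infinite: "\<not> finite_exp \<alpha> \<Longrightarrow> coeff f \<alpha> = 0"
  using coeff[of f] by auto

lemma mps_eqI: "(\<And>\<alpha>. finite_exp \<alpha> \<Longrightarrow> coeff f \<alpha> = coeff g \<alpha>) \<Longrightarrow> f = g"
  by (metis coeff_infinite coeff_inject ext)

lemma mps_eq_iff: "f = g \<longleftrightarrow> (\<forall>\<alpha>. coeff f \<alpha> = coeff g \<alpha>)"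
  by (auto intro: mps_eqI)

lemma finite_exp_zero [simp]: "finite_exp 0"
  by (simp add: finite_exp_def)

lemma finite_exp_add [simp]: "finite_exp (\<alpha> + \<beta>) \<longleftrightarrow> finite_exp \<alpha> \<and> finite_exp \<beta>"
proof -
  have "{i. (\<alpha> + \<beta>) i \<noteq> 0} = {i. \<alpha> i \<noteq> 0} \<union> {i. \<beta> i \<noteq> 0}" by auto
  then show ?thesis by (simp add: finite_exp_def)
qed

lemma finite_exp_below:
  assumes "finite_exp \<alpha>" shows "finite {\<beta>. \<beta> \<le> \<alpha>}"
proof -
  let ?S = "{i. \<alpha> i \<noteq> 0}"
  have "\<beta> \<in> {f. \<forall>i. (i \<in> ?S \<longrightarrow> f i \<in> {..Max (\<alpha> ` ?S)}) \<and> (i \<notin> ?S \<longrightarrow> f i = 0)}"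
    if "\<beta> \<le> \<alpha>" for \<beta>
  proof -
    have "\<beta> i \<le> Max (\<alpha> ` ?S)" if "i \<in> ?S" for i
      using assms that \<open>\<beta> \<le> \<alpha>\<close> unfolding finite_exp_def
      by (metis (no_types, lifting) Max_ge finite_imageI imageI le_funD le_trans)
    moreover have "\<beta> i = 0" if "i \<notin> ?S" for i
      using le_funD[OF \<open>\<beta> \<le> \<alpha>\<close>, of i] that by simp
    ultimately show ?thesis by simp
  qed
  moreover have "finite {f. \<forall>i. (i \<in> ?S \<longrightarrow> f i \<in> {..Max (\<alpha> ` ?S)}) \<and> (i \<notin> ?S \<longrightarrow> f i = 0)}"
    using assms unfolding finite_exp_def by (intro finite_set_of_finite_funs) auto
  ultimately show ?thesis by (elim finite_subset[rotated]) blast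
qed

text \<open>With pairs in place of a bound and a subtraction, convolution is symmetric in its
  factors and the ring axioms become reindexings of sums.\<close>

definition splits :: "(nat \<Rightarrow> nat) \<Rightarrow> ((nat \<Rightarrow> nat) \<times> (nat \<Rightarrow> nat)) set" where
  "splits \<alpha> = {(\<beta>, \<gamma>). \<beta> + \<gamma> = \<alpha>}"

lemma exp_add_diff: "(\<beta> :: nat \<Rightarrow> nat) \<le> \<alpha> \<Longrightarrow> \<beta> + (\<alpha> - \<beta>) = \<alpha>"
  by (auto simp: le_fun_def fun_eq_iff)

lemma exp_le_add: "(\<beta> :: nat \<Rightarrow> nat) \<le> \<beta> + \<gamma>" "\<gamma> \<le> \<beta> + \<gamma>"
  by (auto simp: le_fun_def)

lemma exp_add_diff_cancel: "(\<beta> + \<gamma>) - \<beta> = (\<gamma> :: nat \<Rightarrow> nat)"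
  by (auto simp: fun_eq_iff)

lemma splits_eq_image: "splits \<alpha> = (\<lambda>\<beta>. (\<beta>, \<alpha> - \<beta>)) ` {\<beta>. \<beta> \<le> \<alpha>}"
  unfolding splits_def by (auto simp: exp_add_diff exp_le_add exp_add_diff_cancel image_iff)

lemma finite_splits: "finite_exp \<alpha> \<Longrightarrow> finite (splits \<alpha>)"
  by (simp add: splits_eq_image finite_exp_below)

lemma tate_mult_conv_splits: "tate_mult f g \<alpha> = (\<Sum>(\<beta>, \<gamma>)\<in>splits \<alpha>. f \<beta> * g \<gamma>)"
proof -
  have "(\<lambda>i. \<alpha> i - \<beta> i) = \<alpha> - \<beta>" for \<beta> by (auto simp: fun_eq_iff)
  then show ?thesis
    unfolding tate_mult_def splits_eq_image le_fun_def[symmetric]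
    by (subst sum.reindex) (auto simp: inj_on_def)
qed

instantiation mps :: (zero) zero
begin
lift_definition zero_mps :: "'a mps" is "\<lambda>_. 0" by simp
instance ..
end

instantiation mps :: (comm_ring_1) comm_ring_1
begin

lift_definition one_mps :: "'a mps" is "\<lambda>\<alpha>. if \<alpha> = 0 then 1 else 0" by auto

lift_definition plus_mps :: "'a mps \<Rightarrow> 'a mps \<Rightarrow> 'a mps" is "\<lambda>f g \<alpha>. f \<alpha> + g \<alpha>" by auto

lift_definition minus_mps :: "'a mps \<Rightarrow> 'a mps \<Rightarrow> 'a mps" is "\<lambda>f g \<alpha>. f \<alpha> - g \<alpha>" by auto

lift_definition uminus_mps :: "'a mps \<Rightarrow> 'a mps" is "\<lambda>f \<alpha>. - f \<alpha>" by auto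

lift_definition times_mps :: "'a mps \<Rightarrow> 'a mps \<Rightarrow> 'a mps" is
  "\<lambda>f g \<alpha>. if finite_exp \<alpha> then \<Sum>(\<beta>, \<gamma>)\<in>splits \<alpha>. f \<beta> * g \<gamma> else 0" by auto

instance
proof
  fix f g h :: "'a mps"
  show "f + g + h = f + (g + h)" "f + g = g + f" "0 + f = f" "- f + f = 0" "f - g = f + - g"
    by (auto intro!: mps_eqI simp: zero_mps.rep_eq plus_mps.rep_eq minus_mps.rep_eq uminus_mps.rep_eq)
  show "f * g = g * f"
  proof (rule mps_eqI)
    fix \<alpha> :: "nat \<Rightarrow> nat" assume "finite_exp \<alpha>"
    then show "coeff (f * g) \<alpha> = coeff (g * f) \<alpha>"
      by (simp add: times_mps.rep_eq case_prod_unfold)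
        (rule sum.reindex_bij_witness[of _ prod.swap prod.swap],
          auto simp: splits_def algebra_simps)
  qed
  show "f * g * h = f * (g * h)"
  proof (rule mps_eqI)
    fix \<alpha> :: "nat \<Rightarrow> nat" assume fin: "finite_exp \<alpha>"
    then have fin1: "(\<beta>, \<gamma>) \<in> splits \<alpha> \<Longrightarrow> finite_exp \<beta> \<and> finite_exp \<gamma>" for \<beta> \<gamma>
      by (auto simp: splits_def)
    \<comment> \<open>Both bracketings are sums over triples of exponents with total
      \<open>\<alpha>\<close>; the bijection used below only regroups the triple.\<close>
    have "coeff (f * g * h) \<alpha>
        = (\<Sum>(\<beta>, \<gamma>)\<in>splits \<alpha>. \<Sum>(\<delta>, \<epsilon>)\<in>splits \<beta>. coeff f \<delta> * coeff g \<epsilon> * coeff h \<gamma>)"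
      using fin fin1 by (auto simp: times_mps.rep_eq sum_distrib_right case_prod_unfold intro!: sum.cong)
    also have "\<dots> = (\<Sum>((\<beta>, \<gamma>), (\<delta>, \<epsilon>))\<in>Sigma (splits \<alpha>) (\<lambda>(\<beta>, \<gamma>). splits \<beta>).
        coeff f \<delta> * coeff g \<epsilon> * coeff h \<gamma>)"
      using fin fin1 finite_splits by (subst sum.Sigma[symmetric]) (auto simp: case_prod_unfold)
    also have "\<dots> = (\<Sum>((\<beta>, \<gamma>), (\<delta>, \<epsilon>))\<in>Sigma (splits \<alpha>) (\<lambda>(\<beta>, \<gamma>). splits \<gamma>).
        coeff f \<beta> * (coeff g \<delta> * coeff h \<epsilon>))"
      by (rule sum.reindex_bij_witness
          [of _ "\<lambda>((\<beta>, \<gamma>), (\<delta>, \<epsilon>)). ((\<beta> + \<delta>, \<epsilon>), (\<beta>, \<delta>))"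
            "\<lambda>((\<beta>, \<gamma>), (\<delta>, \<epsilon>)). ((\<delta>, \<epsilon> + \<gamma>), (\<epsilon>, \<gamma>))"])
        (auto simp: splits_def algebra_simps)
    also have "\<dots> = (\<Sum>(\<beta>, \<gamma>)\<in>splits \<alpha>. \<Sum>(\<delta>, \<epsilon>)\<in>splits \<gamma>. coeff f \<beta> * (coeff g \<delta> * coeff h \<epsilon>))"
      using fin fin1 finite_splits by (subst sum.Sigma[symmetric]) (auto simp: case_prod_unfold)
    also have "\<dots> = coeff (f * (g * h)) \<alpha>"
      using fin fin1 by (auto simp: times_mps.rep_eq sum_distrib_left case_prod_unfold intro!: sum.cong)
    finally show "coeff (f * g * h) \<alpha> = coeff (f * (g * h)) \<alpha>" .
  qed
  show "1 * f = f"
  proof (rule mps_eqI)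
    fix \<alpha> :: "nat \<Rightarrow> nat" assume fin: "finite_exp \<alpha>"
    have "coeff (1 * f) \<alpha> = (\<Sum>x\<in>splits \<alpha>. if x = (0, \<alpha>) then coeff f \<alpha> else 0)"
      using fin unfolding times_mps.rep_eq one_mps.rep_eq
      by (auto simp: splits_def intro!: sum.cong)
    also have "\<dots> = coeff f \<alpha>"
      using fin finite_splits by (auto simp: splits_def)
    finally show "coeff (1 * f) \<alpha> = coeff f \<alpha>" .
  qed
  show "(f + g) * h = f * h + g * h"
    by (rule mps_eqI) (simp add: times_mps.rep_eq plus_mps.rep_eq case_prod_unfold
        algebra_simps sum.distrib)
  show "(0 :: 'a mps) \<noteq> 1"
    by (metis one_mps.rep_eq zero_mps.rep_eq zero_neq_one)
qed

end

lemma coeff_0 [simp]: "coeff 0 \<alpha> = 0"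
  and coeff_1: "coeff 1 \<alpha> = (if \<alpha> = 0 then 1 else 0)"
  and coeff_add [simp]: "coeff (f + g) \<alpha> = coeff f \<alpha> + coeff g \<alpha>"
  and coeff_diff [simp]: "coeff (f - g) \<alpha> = coeff f \<alpha> - coeff g \<alpha>"
  and coeff_minus [simp]: "coeff (- f) \<alpha> = - coeff f \<alpha>"
  by (simp_all add: zero_mps.rep_eq one_mps.rep_eq plus_mps.rep_eq minus_mps.rep_eq uminus_mps.rep_eq)

lemma coeff_mult: "finite_exp \<alpha> \<Longrightarrow> coeff (f * g) \<alpha> = (\<Sum>(\<beta>, \<gamma>)\<in>splits \<alpha>. coeff f \<beta> * coeff g \<gamma>)"
  by (simp add: times_mps.rep_eq)

lemma coeff_sum [simp]: "coeff (sum f A) \<alpha> = (\<Sum>i\<in>A. coeff (f i) \<alpha>)"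
  by (induction A rule: infinite_finite_induct) auto

lift_definition mterm :: "(nat \<Rightarrow> nat) \<Rightarrow> 'a \<Rightarrow> 'a::zero mps" is
  "\<lambda>\<mu> a \<alpha>. if \<alpha> = \<mu> \<and> finite_exp \<mu> then a else 0" by auto

lemma coeff_mterm: "finite_exp \<mu> \<Longrightarrow> coeff (mterm \<mu> a) \<alpha> = (if \<alpha> = \<mu> then a else 0)"
  by (simp add: mterm.rep_eq)

lemma coeff_mterm_mult:
  assumes "finite_exp \<mu>"
  shows "coeff (mterm \<mu> a * f) \<alpha> = (if \<mu> \<le> \<alpha> then a * coeff f (\<alpha> - \<mu>) else 0)"
proof (cases "finite_exp \<alpha>")
  case True
  have "coeff (mterm \<mu> a * f) \<alpha>
      = (\<Sum>x\<in>splits \<alpha>. if x = (\<mu>, \<alpha> - \<mu>) then a * coeff f (\<alpha> - \<mu>) else 0)"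
    unfolding coeff_mult[OF True]
  proof (intro sum.cong refl)
    fix x assume "x \<in> splits \<alpha>"
    then obtain \<beta> \<gamma> where x: "x = (\<beta>, \<gamma>)" and \<alpha>: "\<alpha> = \<beta> + \<gamma>"
      by (auto simp: splits_def)
    show "(case x of (\<beta>, \<gamma>) \<Rightarrow> coeff (mterm \<mu> a) \<beta> * coeff f \<gamma>)
        = (if x = (\<mu>, \<alpha> - \<mu>) then a * coeff f (\<alpha> - \<mu>) else 0)"
      unfolding x prod.case coeff_mterm[OF assms]
      by (cases "\<beta> = \<mu>") (simp_all only: \<alpha> exp_add_diff_cancel if_True if_False prod.inject
          simp_thms mult_zero_left)
  qed
  also have "\<dots> = (if (\<mu>, \<alpha> - \<mu>) \<in> splits \<alpha> then a * coeff f (\<alpha> - \<mu>) else 0)"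
    using finite_splits[OF True] by simp
  also have "(\<mu>, \<alpha> - \<mu>) \<in> splits \<alpha> \<longleftrightarrow> \<mu> \<le> \<alpha>"
    by (auto simp: splits_eq_image)
  finally show ?thesis .
next
  case False
  then have "\<mu> \<le> \<alpha> \<Longrightarrow> \<not> finite_exp (\<alpha> - \<mu>)"
    using assms by (metis exp_add_diff finite_exp_add)
  with False show ?thesis by (auto simp: coeff_infinite)
qed

lemma coeff_mterm_mult_add: "finite_exp \<mu> \<Longrightarrow> coeff (mterm \<mu> a * f) (\<mu> + \<alpha>) = a * coeff f \<alpha>"
  by (simp add: coeff_mterm_mult exp_le_add exp_add_diff_cancel)

abbreviation const :: "'a::zero \<Rightarrow> 'a mps" where "const \<equiv> mterm 0"

lemma exp_diff_0 [simp]: "\<alpha> - 0 = (\<alpha> :: nat \<Rightarrow> nat)" "(0 :: nat \<Rightarrow> nat) \<le> \<alpha>"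
  by (auto simp: fun_eq_iff le_fun_def)

lemma coeff_const: "coeff (const a) \<alpha> = (if \<alpha> = 0 then a else 0)"
  by (simp add: coeff_mterm)

lemma coeff_const_mult [simp]: "coeff (const a * f) \<alpha> = a * coeff f \<alpha>"
  by (simp add: coeff_mterm_mult)

lemma const_1: "const 1 = 1"
  by (simp add: mps_eq_iff coeff_const coeff_1)

lemma const_add: "const (a + b) = const a + const b"
  and const_mult: "const (a * b) = const a * const b"
  and const_diff: "const (a - b) = const a - const b"
  and const_minus: "const (- a) = - const a"
  and const_0: "const 0 = 0"
  by (auto simp: mps_eq_iff coeff_const)

lemma const_power: "const (a ^ n) = const a ^ n"
  by (induction n) (simp_all only: power_0 power_Suc const_1 const_mult)

lemma mterm_mult: "finite_exp \<mu> \<Longrightarrow> finite_exp \<nu> \<Longrightarrow> mterm \<mu> a * mterm \<nu> b = mterm (\<mu> + \<nu>) (a * b)"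
  by (auto simp: mps_eq_iff coeff_mterm_mult coeff_mterm exp_add_diff_cancel exp_le_add)
    (metis exp_add_diff)+

section \<open>Rings of convergent power series\<close>

locale nonarch_field =
  fixes v :: "'k::field \<Rightarrow> real"
  assumes nonarch: "nonarch_abs v"
begin

lemma v_nonneg [simp]: "0 \<le> v x"
  and v_eq_0_iff [simp]: "v x = 0 \<longleftrightarrow> x = 0"
  and v_mult: "v (x * y) = v x * v y"
  and v_add_le: "v (x + y) \<le> max (v x) (v y)"
  using nonarch by (auto simp: nonarch_abs_def)

lemma v_0 [simp]: "v 0 = 0"
  by simp

lemma v_pos_iff [simp]: "0 < v x \<longleftrightarrow> x \<noteq> 0"
  using v_nonneg[of x] v_eq_0_iff[of x] by linarith

lemma v_1 [simp]: "v 1 = 1"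
  using v_mult[of 1 1] v_eq_0_iff[of 1] by simp

lemma v_minus [simp]: "v (- x) = v x"
proof -
  have "v (-1) ^ 2 = 1" using v_mult[of "-1" "-1"] by (simp add: power2_eq_square)
  then have "v (-1) = 1" using v_nonneg[of "-1"] by (simp add: power2_eq_1_iff)
  then show ?thesis using v_mult[of "-1" x] by simp
qed

lemma v_diff_le: "v (x - y) \<le> max (v x) (v y)"
  using v_add_le[of x "- y"] by simp

lemma v_diff_commute: "v (x - y) = v (y - x)"
  by (metis minus_diff_eq v_minus)

lemma v_power: "v (x ^ n) = v x ^ n"
  by (induction n) (auto simp: v_mult)

lemma v_sum_le: "(\<And>i. i \<in> A \<Longrightarrow> v (f i) \<le> B) \<Longrightarrow> 0 \<le> B \<Longrightarrow> v (sum f A) \<le> B"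
proof (induction A rule: infinite_finite_induct)
  case (insert x F)
  then show ?case using v_add_le[of "f x" "sum f F"] by fastforce
qed auto

text \<open>Series converging for |y| \<le> r and absolute value at most 1 of the other variables,
  where y denotes variable number \<open>D\<close>. Only y carries the radius r; for r = 1 this is
  the Tate algebra.\<close>

definition T :: "nat \<Rightarrow> real \<Rightarrow> 'k mps set" where
  "T D r = {f. (\<forall>\<alpha>. \<alpha> \<notin> monomials D \<longrightarrow> coeff f \<alpha> = 0) \<and>
               (\<forall>e>0. finite {\<alpha>. e \<le> v (coeff f \<alpha>) * r ^ \<alpha> D})}"

text \<open>The Gauss norm on that polydisc is at most \<open>B\<close>.\<close>

definition nb :: "nat \<Rightarrow> real \<Rightarrow> real \<Rightarrow> 'k mps \<Rightarrow> bool" where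
  "nb D r B f \<longleftrightarrow> (\<forall>\<alpha>. v (coeff f \<alpha>) * r ^ \<alpha> D \<le> B)"

lemma monomials_finite_exp: "\<alpha> \<in> monomials D \<Longrightarrow> finite_exp \<alpha>"
  unfolding finite_exp_def monomials_def
  by (rule finite_subset[of _ "{..D}"]) (auto intro: leI)

lemma monomials_0 [simp]: "0 \<in> monomials D"
  by (simp add: monomials_def)

lemma monomials_add [simp]: "\<alpha> + \<beta> \<in> monomials D \<longleftrightarrow> \<alpha> \<in> monomials D \<and> \<beta> \<in> monomials D"
  by (auto simp: monomials_def)

lemma T_coeff_outside: "f \<in> T D r \<Longrightarrow> \<alpha> \<notin> monomials D \<Longrightarrow> coeff f \<alpha> = 0"
  by (simp add: T_def)

lemma T_finite: "f \<in> T D r \<Longrightarrow> e > 0 \<Longrightarrow> finite {\<alpha>. e \<le> v (coeff f \<alpha>) * r ^ \<alpha> D}"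
  by (simp add: T_def)

lemma TI:
  assumes "\<And>\<alpha>. \<alpha> \<notin> monomials D \<Longrightarrow> coeff f \<alpha> = 0"
    and "\<And>e. e > 0 \<Longrightarrow> finite {\<alpha>. e \<le> v (coeff f \<alpha>) * r ^ \<alpha> D}"
  shows "f \<in> T D r"
  using assms by (simp add: T_def)

lemma nbD: "nb D r B f \<Longrightarrow> v (coeff f \<alpha>) * r ^ \<alpha> D \<le> B"
  by (simp add: nb_def)

lemma nb_mono: "nb D r B f \<Longrightarrow> B \<le> C \<Longrightarrow> nb D r C f"
  unfolding nb_def using order_trans by blast

context
  fixes r :: real assumes r: "r > 0"
begin

lemma nb_nonneg: "nb D r B f \<Longrightarrow> 0 \<le> B"
  using r by (metis nbD order_trans v_nonneg zero_le_mult_iff zero_le_power less_imp_le)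

lemma nb_add: "nb D r B f \<Longrightarrow> nb D r B g \<Longrightarrow> nb D r B (f + g)"
  unfolding nb_def
proof
  fix \<alpha>
  assume 1: "\<forall>\<alpha>. v (coeff f \<alpha>) * r ^ \<alpha> D \<le> B" "\<forall>\<alpha>. v (coeff g \<alpha>) * r ^ \<alpha> D \<le> B"
  have "v (coeff (f + g) \<alpha>) * r ^ \<alpha> D \<le> max (v (coeff f \<alpha>)) (v (coeff g \<alpha>)) * r ^ \<alpha> D"
    using v_add_le[of "coeff f \<alpha>" "coeff g \<alpha>"] r by (simp add: mult_right_mono)
  also have "\<dots> \<le> B" using 1 by (auto simp: max_def)
  finally show "v (coeff (f + g) \<alpha>) * r ^ \<alpha> D \<le> B" .
qed

lemma nb_minus: "nb D r B f \<Longrightarrow> nb D r B (- f)"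
  by (simp add: nb_def)

lemma nb_diff: "nb D r B f \<Longrightarrow> nb D r B g \<Longrightarrow> nb D r B (f - g)"
  using nb_add[of D B f "- g"] nb_minus[of D B g] by simp

lemma nb_0: "0 \<le> B \<Longrightarrow> nb D r B 0"
  by (simp add: nb_def)

lemma nb_sum: "(\<And>i. i \<in> A \<Longrightarrow> nb D r B (f i)) \<Longrightarrow> 0 \<le> B \<Longrightarrow> nb D r B (sum f A)"
  by (induction A rule: infinite_finite_induct) (auto intro: nb_add nb_0)

lemma nb_mult:
  assumes "nb D r B f" "nb D r C g" shows "nb D r (B * C) (f * g)"
  unfolding nb_def
proof
  fix \<alpha>
  have BC: "0 \<le> B" "0 \<le> C" using assms nb_nonneg by auto
  show "v (coeff (f * g) \<alpha>) * r ^ \<alpha> D \<le> B * C"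
  proof (cases "finite_exp \<alpha>")
    case True
    have "v (coeff (f * g) \<alpha>) \<le> B * C / r ^ \<alpha> D"
      unfolding coeff_mult[OF True]
    proof (rule v_sum_le)
      fix x assume x: "x \<in> splits \<alpha>"
      obtain \<beta> \<gamma> where [simp]: "x = (\<beta>, \<gamma>)" by fastforce
      have \<alpha>: "\<alpha> = \<beta> + \<gamma>" using x by (auto simp: splits_def)
      have "(v (coeff f \<beta>) * r ^ \<beta> D) * (v (coeff g \<gamma>) * r ^ \<gamma> D) \<le> B * C"
        using assms r BC by (intro mult_mono) (auto simp: nb_def)
      then show "v (case x of (\<beta>, \<gamma>) \<Rightarrow> coeff f \<beta> * coeff g \<gamma>) \<le> B * C / r ^ \<alpha> D"
        using r by (simp add: \<alpha> v_mult power_add field_simps)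
    qed (use r BC in auto)
    then show ?thesis using r by (simp add: field_simps)
  next
    case False
    then show ?thesis using BC by (simp add: coeff_infinite)
  qed
qed

lemma nb_const_mult: "nb D r B f \<Longrightarrow> nb D r (v a * B) (const a * f)"
  by (auto simp: nb_def v_mult mult.assoc intro: mult_left_mono)

lemma nb_mterm: "finite_exp \<mu> \<Longrightarrow> nb D r (v a * r ^ \<mu> D) (mterm \<mu> a)"
  using r by (simp add: nb_def coeff_mterm)

text \<open>Only finitely many terms have weight at least 1. The 1 inserted into the maximum bounds
  all others and makes the bound positive.\<close>

lemma T_bounded: "f \<in> T D r \<Longrightarrow> \<exists>B>0. nb D r B f"
proof -
  assume f: "f \<in> T D r"
  let ?w = "\<lambda>\<alpha>. v (coeff f \<alpha>) * r ^ \<alpha> D"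
  have fin: "finite (insert 1 (?w ` {\<alpha>. 1 \<le> ?w \<alpha>}))" using T_finite[OF f, of 1] by simp
  define B where "B = Max (insert 1 (?w ` {\<alpha>. 1 \<le> ?w \<alpha>}))"
  have "?w \<alpha> \<le> B" for \<alpha>
  proof (cases "1 \<le> ?w \<alpha>")
    case True
    then show ?thesis unfolding B_def by (intro Max_ge[OF fin]) auto
  next
    case False
    moreover have "1 \<le> B" unfolding B_def by (intro Max_ge[OF fin]) auto
    ultimately show ?thesis by simp
  qed
  moreover have "0 < B" using Max_ge[OF fin, of 1] unfolding B_def by simp
  ultimately show ?thesis unfolding nb_def by blast
qed

lemma T_0 [simp]: "0 \<in> T D r"
  by (simp add: T_def)

lemma T_mterm [simp]: "\<mu> \<in> monomials D \<Longrightarrow> mterm \<mu> a \<in> T D r"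
  by (rule TI) (auto simp: coeff_mterm monomials_finite_exp intro!: finite_subset[of _ "{\<mu>}"])

lemma T_const [simp]: "const a \<in> T D r"
  by (rule T_mterm) simp

lemma T_1 [simp]: "1 \<in> T D r"
  by (metis T_const const_1)

lemma T_add [simp]: assumes f: "f \<in> T D r" and g: "g \<in> T D r" shows "f + g \<in> T D r"
proof (rule TI)
  fix e :: real assume "e > 0"
  have "{\<alpha>. e \<le> v (coeff (f + g) \<alpha>) * r ^ \<alpha> D}
      \<subseteq> {\<alpha>. e \<le> v (coeff f \<alpha>) * r ^ \<alpha> D} \<union> {\<alpha>. e \<le> v (coeff g \<alpha>) * r ^ \<alpha> D}"
  proof
    fix \<alpha> assume "\<alpha> \<in> {\<alpha>. e \<le> v (coeff (f + g) \<alpha>) * r ^ \<alpha> D}"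
    then have "e \<le> max (v (coeff f \<alpha>)) (v (coeff g \<alpha>)) * r ^ \<alpha> D"
      using v_add_le[of "coeff f \<alpha>" "coeff g \<alpha>"] r
      by (auto elim!: order_trans intro!: mult_right_mono)
    then show "\<alpha> \<in> {\<alpha>. e \<le> v (coeff f \<alpha>) * r ^ \<alpha> D} \<union> {\<alpha>. e \<le> v (coeff g \<alpha>) * r ^ \<alpha> D}"
      by (auto simp: max_def split: if_splits)
  qed
  then show "finite {\<alpha>. e \<le> v (coeff (f + g) \<alpha>) * r ^ \<alpha> D}"
    using T_finite[OF f \<open>e > 0\<close>] T_finite[OF g \<open>e > 0\<close>] finite_subset by blast
qed (use f g in \<open>auto simp: T_coeff_outside\<close>)

lemma T_minus [simp]: "f \<in> T D r \<Longrightarrow> - f \<in> T D r"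
  by (simp add: T_def)

lemma T_diff [simp]: "f \<in> T D r \<Longrightarrow> g \<in> T D r \<Longrightarrow> f - g \<in> T D r"
  using T_add[of f D "- g"] T_minus[of g] by simp

lemma T_sum [simp]: "(\<And>i. i \<in> A \<Longrightarrow> f i \<in> T D r) \<Longrightarrow> sum f A \<in> T D r"
  by (induction A rule: infinite_finite_induct) auto

lemma T_mult [simp]: assumes f: "f \<in> T D r" and g: "g \<in> T D r" shows "f * g \<in> T D r"
proof (rule TI)
  fix \<alpha> assume \<alpha>: "\<alpha> \<notin> monomials D"
  show "coeff (f * g) \<alpha> = 0"
  proof (cases "finite_exp \<alpha>")
    case True
    have "coeff f \<beta> * coeff g \<gamma> = 0" if "(\<beta>, \<gamma>) \<in> splits \<alpha>" for \<beta> \<gamma>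
      using that \<alpha> T_coeff_outside[OF f] T_coeff_outside[OF g] by (auto simp: splits_def)
    then show ?thesis by (auto simp: coeff_mult[OF True] intro!: sum.neutral)
  qed (simp add: coeff_infinite)
next
  fix e :: real assume "e > 0"
  let ?wf = "\<lambda>\<alpha>. v (coeff f \<alpha>) * r ^ \<alpha> D" and ?wg = "\<lambda>\<alpha>. v (coeff g \<alpha>) * r ^ \<alpha> D"
  obtain B C where B: "B > 0" "nb D r B f" and C: "C > 0" "nb D r C g"
    using T_bounded f g by meson
  have "{\<alpha>. e \<le> v (coeff (f * g) \<alpha>) * r ^ \<alpha> D}
      \<subseteq> (\<lambda>(\<beta>, \<gamma>). \<beta> + \<gamma>) ` ({\<alpha>. e / (2 * C) \<le> ?wf \<alpha>} \<times> {\<alpha>. e / (2 * B) \<le> ?wg \<alpha>})"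
  proof
    fix \<alpha> assume "\<alpha> \<in> {\<alpha>. e \<le> v (coeff (f * g) \<alpha>) * r ^ \<alpha> D}"
    then have *: "e \<le> v (coeff (f * g) \<alpha>) * r ^ \<alpha> D" by simp
    have fin: "finite_exp \<alpha>"
    proof (rule ccontr)
      assume "\<not> finite_exp \<alpha>"
      then show False using * \<open>e > 0\<close> by (simp add: coeff_infinite)
    qed
    \<comment> \<open>By the ultrametric inequality a single product already has weight above e/2;
      the bounds \<open>B\<close> and \<open>C\<close> then confine both factors to finite sets.
      Halving e leaves room for the non-strict \<open>v_sum_le\<close>.\<close>
    have "\<exists>x\<in>splits \<alpha>. e / (2 * r ^ \<alpha> D) < v (case x of (\<beta>, \<gamma>) \<Rightarrow> coeff f \<beta> * coeff g \<gamma>)"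
    proof (rule ccontr)
      assume "\<not> ?thesis"
      then have "v (coeff (f * g) \<alpha>) \<le> e / (2 * r ^ \<alpha> D)"
        unfolding coeff_mult[OF fin] using r \<open>e > 0\<close> by (intro v_sum_le) (auto simp: not_less)
      then have "v (coeff (f * g) \<alpha>) * r ^ \<alpha> D \<le> e / 2" using r by (simp add: field_simps)
      with * \<open>e > 0\<close> show False by simp
    qed
    then obtain \<beta> \<gamma> where \<alpha>: "\<alpha> = \<beta> + \<gamma>" and "e / (2 * r ^ \<alpha> D) < v (coeff f \<beta> * coeff g \<gamma>)"
      by (auto simp: splits_def)
    then have big: "e / 2 < ?wf \<beta> * ?wg \<gamma>" using r by (simp add: v_mult power_add field_simps)
    have "?wf \<beta> * ?wg \<gamma> \<le> ?wf \<beta> * C" "?wf \<beta> * ?wg \<gamma> \<le> B * ?wg \<gamma>"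
      using B C r by (auto simp: nb_def intro!: mult_mono)
    then have "e / (2 * C) \<le> ?wf \<beta>" "e / (2 * B) \<le> ?wg \<gamma>"
      using big B C by (auto simp: field_simps)
    then show "\<alpha> \<in> (\<lambda>(\<beta>, \<gamma>). \<beta> + \<gamma>) ` ({\<alpha>. e / (2 * C) \<le> ?wf \<alpha>} \<times> {\<alpha>. e / (2 * B) \<le> ?wg \<alpha>})"
      using \<alpha> by force
  qed
  moreover have "finite ({\<alpha>. e / (2 * C) \<le> ?wf \<alpha>} \<times> {\<alpha>. e / (2 * B) \<le> ?wg \<alpha>})"
    using T_finite[OF f] T_finite[OF g] B C \<open>e > 0\<close> by simp
  ultimately show "finite {\<alpha>. e \<le> v (coeff (f * g) \<alpha>) * r ^ \<alpha> D}"
    by (meson finite_imageI finite_subset)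
qed

lemma T_power [simp]: "f \<in> T D r \<Longrightarrow> f ^ n \<in> T D r"
  by (induction n) auto

end

lemma T_antimono: assumes "0 < r'" "r' \<le> r" shows "T D r \<subseteq> T D r'"
proof
  fix f assume f: "f \<in> T D r"
  show "f \<in> T D r'"
  proof (rule TI)
    fix e :: real assume "e > 0"
    have "{\<alpha>. e \<le> v (coeff f \<alpha>) * r' ^ \<alpha> D} \<subseteq> {\<alpha>. e \<le> v (coeff f \<alpha>) * r ^ \<alpha> D}"
      using assms by (auto elim!: order_trans intro!: mult_left_mono power_mono)
    then show "finite {\<alpha>. e \<le> v (coeff f \<alpha>) * r' ^ \<alpha> D}"
      using T_finite[OF f \<open>e > 0\<close>] finite_subset by blast
  qed (use f in \<open>auto simp: T_coeff_outside\<close>)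
qed

definition free_of :: "nat \<Rightarrow> 'k mps \<Rightarrow> bool" where
  "free_of D f \<longleftrightarrow> (\<forall>\<alpha>. \<alpha> D \<noteq> 0 \<longrightarrow> coeff f \<alpha> = 0)"

text \<open>The weight sees only y, so a series without y that converges on a small disc converges
  on every disc.\<close>

lemma free_of_weight: assumes "free_of D f" "f \<in> T D r" shows "f \<in> T D r'"
proof -
  have "v (coeff f \<alpha>) * r ^ \<alpha> D = v (coeff f \<alpha>) * r' ^ \<alpha> D" for \<alpha>
    using assms(1) by (cases "\<alpha> D = 0") (auto simp: free_of_def)
  with assms(2) show ?thesis by (simp add: T_def)
qed

lemma monomials_Suc: "\<alpha> \<in> monomials D \<longleftrightarrow> \<alpha> \<in> monomials (Suc D) \<and> \<alpha> (Suc D) = 0"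
  by (auto simp: monomials_def) (metis Suc_lessI)

text \<open>A Tate algebra sits in the one with an additional variable as the series free of that
  variable, whatever radius the new variable has.\<close>

lemma T_Suc_iff: "f \<in> T D 1 \<longleftrightarrow> f \<in> T (Suc D) r \<and> free_of (Suc D) f"
proof (cases "free_of (Suc D) f")
  case True
  have "v (coeff f \<alpha>) * 1 ^ \<alpha> D = v (coeff f \<alpha>) * r ^ \<alpha> (Suc D)" for \<alpha>
    using True by (cases "\<alpha> (Suc D) = 0") (auto simp: free_of_def)
  moreover have "(\<forall>\<alpha>. \<alpha> \<notin> monomials D \<longrightarrow> coeff f \<alpha> = 0)
      \<longleftrightarrow> (\<forall>\<alpha>. \<alpha> \<notin> monomials (Suc D) \<longrightarrow> coeff f \<alpha> = 0)"
    using True monomials_Suc unfolding free_of_def by blast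
  ultimately show ?thesis using True by (simp only: T_def mem_Collect_eq simp_thms)
next
  case False
  then obtain \<alpha> where "\<alpha> (Suc D) \<noteq> 0" "coeff f \<alpha> \<noteq> 0" by (auto simp: free_of_def)
  then have "f \<notin> T D 1" using T_coeff_outside[of f D 1 \<alpha>] monomials_Suc[of \<alpha> D] by auto
  with False show ?thesis by simp
qed

lemma coeff_truncation:
  assumes "finite N" "\<And>\<nu>. \<nu> \<in> N \<Longrightarrow> finite_exp \<nu>"
  shows "coeff (\<Sum>\<nu>\<in>N. mterm \<nu> (coeff f \<nu>)) \<alpha> = (if \<alpha> \<in> N then coeff f \<alpha> else 0)"
  using assms by (simp add: coeff_mterm)

end

section \<open>Completeness: geometrically convergent sums\<close>

lemma geometric_below:
  assumes "0 < x" "0 < \<theta>" "\<theta> < (1::real)"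
  shows "\<exists>N. \<theta> ^ N * C < x"
proof -
  have "(\<lambda>N. \<theta> ^ N * C) \<longlonglongrightarrow> 0 * C"
    using assms by (intro tendsto_mult_right LIMSEQ_realpow_zero) auto
  then have "\<forall>\<^sub>F N in sequentially. \<theta> ^ N * C < x"
    using assms by (simp add: order_tendstoD)
  then show ?thesis by (auto simp: eventually_sequentially)
qed

lemma le_zero_of_geometric_bound:
  assumes "\<And>N. x \<le> \<theta> ^ N * (C::real)" "0 < \<theta>" "\<theta> < 1"
  shows "x \<le> 0"
  using geometric_below[of x \<theta> C] assms by (meson not_le)

locale complete_nonarch_field = nonarch_field v for v :: "'k::field \<Rightarrow> real" +
  assumes complete: "complete_wrt v"
begin

lemma complete_limit:
  fixes s :: "nat \<Rightarrow> 'k"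
  assumes "\<forall>e>0. \<exists>N. \<forall>m\<ge>N. \<forall>n\<ge>N. v (s m - s n) < e"
  shows "\<exists>L. \<forall>e>0. \<exists>N. \<forall>n\<ge>N. v (s n - L) < e"
  using assms by (rule complete[unfolded complete_wrt_def, THEN spec, THEN mp])

lemma geometric_sum_limit:
  assumes "\<And>n. v (f n) \<le> \<theta> ^ n * C" "0 < \<theta>" "\<theta> < 1" "0 \<le> C"
  shows "\<exists>L. \<forall>N. v (L - (\<Sum>n<N. f n)) \<le> \<theta> ^ N * C"
proof -
  define P where "P N = (\<Sum>n<N. f n)" for N
  have diff: "v (P m - P N) \<le> \<theta> ^ N * C" if "N \<le> m" for N m
  proof -
    have "P m - P N = (\<Sum>n\<in>{N..<m}. f n)"
      unfolding P_def using sum_diff_nat_ivl[of 0 N m f] that by (simp add: atLeast0LessThan)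
    also have "v \<dots> \<le> \<theta> ^ N * C"
    proof (rule v_sum_le)
      fix n assume "n \<in> {N..<m}"
      then have "\<theta> ^ n * C \<le> \<theta> ^ N * C"
        using assms by (intro mult_right_mono power_decreasing) auto
      then show "v (f n) \<le> \<theta> ^ N * C" using assms(1)[of n] by linarith
    qed (use assms in auto)
    finally show ?thesis .
  qed
  have "\<exists>N. \<forall>m\<ge>N. \<forall>n\<ge>N. v (P m - P n) < e" if "e > 0" for e
  proof -
    obtain N where N: "\<theta> ^ N * C < e"
      using geometric_below[of e \<theta> C] assms \<open>e > 0\<close> by blast
    have "v (P m - P n) < e" if "m \<ge> N" "n \<ge> N" for m n
    proof -
      have "v (P m - P n) = v ((P m - P N) - (P n - P N))" by simp
      also have "\<dots> \<le> max (v (P m - P N)) (v (P n - P N))" by (rule v_diff_le)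
      also have "\<dots> \<le> \<theta> ^ N * C" using diff that by simp
      finally show ?thesis using N by simp
    qed
    then show ?thesis by blast
  qed
  then obtain L where L: "\<forall>e>0. \<exists>N. \<forall>n\<ge>N. v (P n - L) < e"
    using complete_limit[of P] by blast
  \<comment> \<open>If L were farther from \<open>P N\<close> than the bound allows, a late partial
    sum would be closer than that to both, against the ultrametric inequality.\<close>
  have "v (L - P N) \<le> \<theta> ^ N * C" for N
  proof (rule ccontr)
    assume *: "\<not> ?thesis"
    then have "v (L - P N) > 0" using assms by (smt (verit) mult_nonneg_nonneg zero_le_power)
    then obtain M where M: "\<forall>n\<ge>M. v (P n - L) < v (L - P N)" using L by blast
    define n where "n = max M N"
    have "v (L - P N) = v ((P n - P N) - (P n - L))" by simp
    also have "\<dots> \<le> max (v (P n - P N)) (v (P n - L))" by (rule v_diff_le)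
    also have "\<dots> < v (L - P N)" using M diff[of N n] * by (auto simp: n_def)
    finally show False by simp
  qed
  then show ?thesis unfolding P_def by blast
qed

lemma T_geometric_sum:
  assumes r: "r > 0" and T: "\<And>n. f n \<in> T D r" and nb: "\<And>n. nb D r (\<theta> ^ n * C) (f n)"
    and \<theta>: "0 < \<theta>" "\<theta> < 1"
  shows "\<exists>F\<in>T D r. \<forall>N. nb D r (\<theta> ^ N * C) (F - (\<Sum>n<N. f n))"
proof -
  have C: "0 \<le> C" using nb_nonneg[OF r nb[of 0]] by simp
  have "\<exists>L. \<forall>N. v (L - (\<Sum>n<N. coeff (f n) \<alpha>)) \<le> \<theta> ^ N * (C / r ^ \<alpha> D)" for \<alpha>
    using nb r \<theta> C by (intro geometric_sum_limit) (auto simp: nb_def field_simps)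
  then obtain L where L: "\<And>\<alpha> N. v (L \<alpha> - (\<Sum>n<N. coeff (f n) \<alpha>)) \<le> \<theta> ^ N * (C / r ^ \<alpha> D)"
    by metis
  \<comment> \<open>Limits are taken coefficientwise. Exponents at which all summands vanish stay at
    0, which makes \<open>Abs_mps L\<close> legitimate and keeps the support in
    \<open>monomials D\<close>.\<close>
  have L0: "L \<alpha> = 0" if "\<And>n. coeff (f n) \<alpha> = 0" for \<alpha>
    using le_zero_of_geometric_bound[of "v (L \<alpha>)" \<theta> "C / r ^ \<alpha> D"] L[of \<alpha>] \<theta> that
      v_nonneg[of "L \<alpha>"] v_eq_0_iff[of "L \<alpha>"] by (simp del: v_nonneg v_eq_0_iff)
  have "\<forall>\<alpha>. \<not> finite_exp \<alpha> \<longrightarrow> L \<alpha> = 0" by (simp add: L0 coeff_infinite)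
  then have coeff: "coeff (Abs_mps L) = L" by (simp add: Abs_mps_inverse)
  have nbF: "nb D r (\<theta> ^ N * C) (Abs_mps L - (\<Sum>n<N. f n))" for N
    using L r by (simp add: nb_def coeff field_simps)
  moreover have "Abs_mps L \<in> T D r"
  proof (rule TI)
    fix e :: real assume "e > 0"
    \<comment> \<open>From this N on the tail has weight below e, so every term of weight at least e
      is already such a term of the partial sum.\<close>
    obtain N where N: "\<theta> ^ N * C < e"
      using geometric_below[of e \<theta> C] \<theta> \<open>e > 0\<close> by blast
    let ?P = "\<Sum>n<N. f n"
    have "{\<alpha>. e \<le> v (coeff (Abs_mps L) \<alpha>) * r ^ \<alpha> D} \<subseteq> {\<alpha>. e \<le> v (coeff ?P \<alpha>) * r ^ \<alpha> D}"
    proof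
      fix \<alpha> assume "\<alpha> \<in> {\<alpha>. e \<le> v (coeff (Abs_mps L) \<alpha>) * r ^ \<alpha> D}"
      then have "e \<le> v ((coeff (Abs_mps L) \<alpha> - coeff ?P \<alpha>) + coeff ?P \<alpha>) * r ^ \<alpha> D" by simp
      also have "\<dots> \<le> max (v (coeff (Abs_mps L) \<alpha> - coeff ?P \<alpha>)) (v (coeff ?P \<alpha>)) * r ^ \<alpha> D"
        using r by (intro mult_right_mono v_add_le) auto
      finally show "\<alpha> \<in> {\<alpha>. e \<le> v (coeff ?P \<alpha>) * r ^ \<alpha> D}"
        using nbD[OF nbF[of N], of \<alpha>] N by (auto simp: max_def split: if_splits)
    qed
    then show "finite {\<alpha>. e \<le> v (coeff (Abs_mps L) \<alpha>) * r ^ \<alpha> D}"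
      by (rule finite_subset) (rule T_finite[OF T_sum[OF r T] \<open>e > 0\<close>])
  qed (use L0 T_coeff_outside[OF T] in \<open>auto simp: coeff\<close>)
  ultimately show ?thesis by blast
qed

end

section \<open>Division with remainder\<close>

text \<open>The order is kept abstract to cover both Weierstrass division by \<open>y - b\<close> and division by
  finitely many series with prescribed leading monomials. A single reduction step leaves an error
  smaller by the factor \<open>\<theta>\<close>, because only finitely many terms of a series exceed a given bound and
  for these one can descend along the well-founded order; completeness does the rest.\<close>

definition standard :: "(nat \<Rightarrow> nat) set \<Rightarrow> 'a::zero mps \<Rightarrow> bool" where
  "standard F s \<longleftrightarrow> (\<forall>\<alpha>. \<forall>m\<in>F. m \<le> \<alpha> \<longrightarrow> coeff s \<alpha> = 0)"

lemma standardD: "standard F s \<Longrightarrow> m \<in> F \<Longrightarrow> m \<le> \<alpha> \<Longrightarrow> coeff s \<alpha> = 0"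
  by (auto simp: standard_def)

context complete_nonarch_field
begin

context
  fixes D :: nat and r \<theta> :: real and ord :: "((nat \<Rightarrow> nat) \<times> (nat \<Rightarrow> nat)) set"
    and F :: "(nat \<Rightarrow> nat) set" and g :: "(nat \<Rightarrow> nat) \<Rightarrow> 'k mps"
  assumes r: "r > 0" and \<theta>: "0 < \<theta>" "\<theta> < 1"
    and wf: "wf ord" and ord_add: "\<And>\<alpha> \<beta> \<gamma>. (\<alpha>, \<beta>) \<in> ord \<Longrightarrow> (\<gamma> + \<alpha>, \<gamma> + \<beta>) \<in> ord"
    and F: "finite F" "F \<subseteq> monomials D"
    and g: "\<And>m. m \<in> F \<Longrightarrow> g m \<in> T D r" "\<And>m. m \<in> F \<Longrightarrow> coeff (g m) m = 1"
    and nb_g: "\<And>m. m \<in> F \<Longrightarrow> nb D r (r ^ m D) (g m)"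
    and small: "\<And>m \<alpha>. m \<in> F \<Longrightarrow> \<alpha> \<noteq> m \<Longrightarrow> (\<alpha>, m) \<notin> ord \<Longrightarrow>
      v (coeff (g m) \<alpha>) * r ^ \<alpha> D \<le> \<theta> * r ^ m D"
begin

text \<open>One round of division at Gauss norm \<open>B\<close>, leaving an error of norm
  \<open>\<theta> * B\<close>. As \<open>g m\<close> has norm \<open>r ^ m D\<close>, the bound on
  \<open>Q m\<close> keeps each product within \<open>B\<close>; these bounds make the iterated
  quotients summable.\<close>

definition reducible_upto :: "real \<Rightarrow> 'k mps \<Rightarrow> bool" where
  "reducible_upto B h \<longleftrightarrow> (\<exists>Q s h'. (\<forall>m\<in>F. Q m \<in> T D r \<and> nb D r (B / r ^ m D) (Q m)) \<and>
     s \<in> T D r \<and> nb D r B s \<and> standard F s \<and> h' \<in> T D r \<and> nb D r (\<theta> * B) h' \<and>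
     h = (\<Sum>m\<in>F. Q m * g m) + s + h')"

lemma reducible_upto_add:
  assumes "reducible_upto B h1" "reducible_upto B h2" shows "reducible_upto B (h1 + h2)"
proof -
  obtain Q1 s1 h1' where 1: "\<forall>m\<in>F. Q1 m \<in> T D r \<and> nb D r (B / r ^ m D) (Q1 m)"
    "s1 \<in> T D r" "nb D r B s1" "standard F s1" "h1' \<in> T D r" "nb D r (\<theta> * B) h1'"
    "h1 = (\<Sum>m\<in>F. Q1 m * g m) + s1 + h1'"
    using assms(1) unfolding reducible_upto_def by blast
  obtain Q2 s2 h2' where 2: "\<forall>m\<in>F. Q2 m \<in> T D r \<and> nb D r (B / r ^ m D) (Q2 m)"
    "s2 \<in> T D r" "nb D r B s2" "standard F s2" "h2' \<in> T D r" "nb D r (\<theta> * B) h2'"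
    "h2 = (\<Sum>m\<in>F. Q2 m * g m) + s2 + h2'"
    using assms(2) unfolding reducible_upto_def by blast
  have "h1 + h2 = (\<Sum>m\<in>F. (Q1 m + Q2 m) * g m) + (s1 + s2) + (h1' + h2')"
    by (simp add: 1(7) 2(7) algebra_simps sum.distrib)
  then show ?thesis
    unfolding reducible_upto_def using 1 2 r
    by (intro exI[of _ "\<lambda>m. Q1 m + Q2 m"] exI[of _ "s1 + s2"] exI[of _ "h1' + h2'"])
      (auto simp: nb_add standard_def)
qed

lemma reducible_upto_scale:
  assumes "reducible_upto B h" "v a * B \<le> C" shows "reducible_upto C (const a * h)"
proof -
  obtain Q s h' where 1: "\<forall>m\<in>F. Q m \<in> T D r \<and> nb D r (B / r ^ m D) (Q m)"
    "s \<in> T D r" "nb D r B s" "standard F s" "h' \<in> T D r" "nb D r (\<theta> * B) h'"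
    "h = (\<Sum>m\<in>F. Q m * g m) + s + h'"
    using assms(1) unfolding reducible_upto_def by blast
  have "nb D r (C / r ^ m D) (const a * Q m)" if "m \<in> F" for m
  proof (rule nb_mono)
    show "nb D r (v a * (B / r ^ m D)) (const a * Q m)"
      using 1(1) that r by (intro nb_const_mult) auto
    show "v a * (B / r ^ m D) \<le> C / r ^ m D" using assms(2) r by (simp add: field_simps)
  qed
  moreover have "nb D r C (const a * s)"
    using nb_mono[OF nb_const_mult[OF r 1(3)]] assms(2) by blast
  moreover have "nb D r (\<theta> * C) (const a * h')"
  proof (rule nb_mono[OF nb_const_mult[OF r 1(6)]])
    show "v a * (\<theta> * B) \<le> \<theta> * C"
      using mult_left_mono[OF assms(2), of \<theta>] \<theta> by (simp add: algebra_simps)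
  qed
  moreover have "const a * h = (\<Sum>m\<in>F. (const a * Q m) * g m) + const a * s + const a * h'"
    by (simp add: 1(7) algebra_simps sum_distrib_left)
  ultimately show ?thesis
    unfolding reducible_upto_def using 1 r
    by (intro exI[of _ "\<lambda>m. const a * Q m"] exI[of _ "const a * s"] exI[of _ "const a * h'"])
      (auto simp: standard_def)
qed

lemma reducible_upto_small:
  assumes "h \<in> T D r" "nb D r (\<theta> * B) h" shows "reducible_upto B h"
proof -
  have "0 \<le> B" using nb_nonneg[OF r assms(2)] \<theta> by (simp add: zero_le_mult_iff)
  then show ?thesis
    unfolding reducible_upto_def using assms r
    by (intro exI[of _ "\<lambda>_. 0"] exI[of _ 0] exI[of _ h]) (auto simp: nb_0 standard_def)
qed

lemma reducible_upto_sum: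
  "(\<And>i. i \<in> A \<Longrightarrow> reducible_upto B (f i)) \<Longrightarrow> 0 \<le> B \<Longrightarrow> reducible_upto B (sum f A)"
proof (induction A rule: infinite_finite_induct)
  case (insert x A)
  then show ?case by (simp add: reducible_upto_add)
next
  case empty
  then show ?case using \<theta> by (auto intro!: reducible_upto_small simp: r nb_0)
next
  case (infinite A)
  then show ?case using \<theta> by (auto intro!: reducible_upto_small simp: r nb_0)
qed

text \<open>Well-founded induction on the monomial. A multiple of some m is exchanged, using a
  monomial multiple of \<open>g m\<close>, for monomials that are lower in \<open>ord\<close> plus a
  part already smaller by the factor \<open>\<theta>\<close>.\<close>

lemma reducible_upto_mterm: "\<mu> \<in> monomials D \<Longrightarrow> reducible_upto (r ^ \<mu> D) (mterm \<mu> 1)"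
  using wf
proof (induction \<mu> rule: wf_induct_rule)
  case (less \<mu>)
  note fin\<mu> = monomials_finite_exp[OF less.prems]
  show ?case
  proof (cases "\<exists>m\<in>F. m \<le> \<mu>")
    case False
    then have "standard F (mterm \<mu> (1 :: 'k))" by (auto simp: standard_def coeff_mterm fin\<mu>)
    moreover have "nb D r (r ^ \<mu> D) (mterm \<mu> 1)" using nb_mterm[OF r fin\<mu>, of D 1] by simp
    ultimately show ?thesis
      unfolding reducible_upto_def using r \<theta> less.prems
      by (intro exI[of _ "\<lambda>_. 0"] exI[of _ "mterm \<mu> 1"] exI[of _ 0]) (auto simp: nb_0)
  next
    case True
    then obtain m where m: "m \<in> F" "m \<le> \<mu>" by blast
    define \<beta> where "\<beta> = \<mu> - m"
    have \<mu>: "\<mu> = \<beta> + m" using exp_add_diff[OF m(2)] by (simp add: \<beta>_def add.commute)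
    have \<beta>: "\<beta> \<in> monomials D" "m \<in> monomials D" using less.prems unfolding \<mu> monomials_add by auto
    \<comment> \<open>The terms of \<open>g m\<close> other than m that are not small. By the
      assumption \<open>small\<close> they all lie below m, and they are finite in number by
      convergence.\<close>
    define N where "N = {\<nu>. \<nu> \<noteq> m \<and> \<theta> * r ^ m D < v (coeff (g m) \<nu>) * r ^ \<nu> D}"
    have N_ord: "(\<nu>, m) \<in> ord" "\<nu> \<in> monomials D" if "\<nu> \<in> N" for \<nu>
    proof -
      show "(\<nu>, m) \<in> ord" using small[OF m(1), of \<nu>] that by (auto simp: N_def)
      show "\<nu> \<in> monomials D"
      proof (rule ccontr)
        assume "\<nu> \<notin> monomials D"
        then have "coeff (g m) \<nu> = 0" using T_coeff_outside[OF g(1)[OF m(1)]] by simp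
        then show False using that r \<theta> by (simp add: N_def mult_less_0_iff not_less)
      qed
    qed
    have finN: "finite N"
      by (rule finite_subset[OF _ T_finite[OF g(1)[OF m(1)], of "\<theta> * r ^ m D"]])
        (use r \<theta> in \<open>auto simp: N_def\<close>)
    define g' where "g' = g m - (\<Sum>\<nu>\<in>insert m N. mterm \<nu> (coeff (g m) \<nu>))"
    have coeff_g': "coeff g' \<alpha> = (if \<alpha> \<in> insert m N then 0 else coeff (g m) \<alpha>)" for \<alpha>
      unfolding g'_def coeff_diff using finN N_ord(2) \<beta>(2) monomials_finite_exp
      by (subst coeff_truncation) auto
    have "nb D r (\<theta> * r ^ m D) g'"
      using r \<theta> by (auto simp: nb_def coeff_g' N_def not_less)
    then have nb': "nb D r (\<theta> * r ^ \<mu> D) (mterm \<beta> 1 * g')"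
      using nb_mult[OF r nb_mterm[OF r monomials_finite_exp[OF \<beta>(1)], of D 1]
          \<open>nb D r (\<theta> * r ^ m D) g'\<close>]
      by (simp add: \<mu> power_add mult_ac)
    have g'T: "g' \<in> T D r"
      unfolding g'_def using g(1)[OF m(1)] N_ord(2) \<beta>(2) by (intro T_diff T_sum r T_mterm) auto
    have split: "g m = mterm m 1 + (\<Sum>\<nu>\<in>N. mterm \<nu> (coeff (g m) \<nu>)) + g'"
      using finN g(2)[OF m(1)] by (simp add: g'_def N_def)
    have "mterm \<beta> 1 * mterm \<nu> (coeff (g m) \<nu>) = const (coeff (g m) \<nu>) * mterm (\<beta> + \<nu>) 1"
      if "\<nu> \<in> N" for \<nu>
      using \<beta>(1) N_ord(2)[OF that] by (simp add: mterm_mult monomials_finite_exp)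
    then have "mterm \<beta> 1 * g m
        = mterm \<mu> 1 + (\<Sum>\<nu>\<in>N. const (coeff (g m) \<nu>) * mterm (\<beta> + \<nu>) 1) + mterm \<beta> 1 * g'"
      using arg_cong[OF split, of "\<lambda>x. mterm \<beta> 1 * x"] \<beta>
      by (simp only: distrib_left sum_distrib_left) (simp add: mterm_mult monomials_finite_exp \<mu>)
    \<comment> \<open>Solved for the monomial to be reduced: a multiple of a divisor, lower
      monomials for the induction hypothesis, and a small error.\<close>
    then have eq: "mterm \<mu> 1 = mterm \<beta> 1 * g m + const (-1) *
        (\<Sum>\<nu>\<in>N. const (coeff (g m) \<nu>) * mterm (\<beta> + \<nu>) 1) + const (-1) * (mterm \<beta> 1 * g')"
      by (simp add: const_minus const_1)
    have "reducible_upto (r ^ \<mu> D) (const (-1) * (mterm \<beta> 1 * g'))"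
      using nb' g'T \<beta>(1) r by (intro reducible_upto_scale[of "r ^ \<mu> D"] reducible_upto_small) auto
    moreover have "reducible_upto (r ^ \<mu> D)
        (const (-1) * (\<Sum>\<nu>\<in>N. const (coeff (g m) \<nu>) * mterm (\<beta> + \<nu>) 1))"
    proof (rule reducible_upto_scale[of "r ^ \<mu> D"], rule reducible_upto_sum)
      fix \<nu> assume \<nu>: "\<nu> \<in> N"
      have "(\<beta> + \<nu>, \<mu>) \<in> ord" using ord_add[OF N_ord(1)[OF \<nu>]] by (simp add: \<mu>)
      then have "reducible_upto (r ^ (\<beta> + \<nu>) D) (mterm (\<beta> + \<nu>) 1)"
        using N_ord(2)[OF \<nu>] \<beta>(1) less.IH[of "\<beta> + \<nu>"] monomials_add by blast
      moreover have "v (coeff (g m) \<nu>) * r ^ (\<beta> + \<nu>) D \<le> r ^ \<mu> D"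
        using mult_left_mono[OF nbD[OF nb_g[OF m(1)], of \<nu>], of "r ^ \<beta> D"] r
        by (simp add: \<mu> power_add algebra_simps)
      ultimately show "reducible_upto (r ^ \<mu> D) (const (coeff (g m) \<nu>) * mterm (\<beta> + \<nu>) 1)"
        by (rule reducible_upto_scale)
    qed (use r in auto)
    moreover have "reducible_upto (r ^ \<mu> D) (mterm \<beta> 1 * g m)"
    proof -
      have "(\<Sum>m'\<in>F. (if m' = m then mterm \<beta> 1 else 0) * g m')
          = (\<Sum>m'\<in>F. if m' = m then mterm \<beta> 1 * g m else 0)"
        by (intro sum.cong) auto
      then have "mterm \<beta> 1 * g m = (\<Sum>m'\<in>F. (if m' = m then mterm \<beta> 1 else 0) * g m') + 0 + 0"
        using F(1) m(1) by simp
      moreover have "nb D r (r ^ \<mu> D / r ^ m D) (mterm \<beta> 1)"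
        using nb_mterm[OF r monomials_finite_exp[OF \<beta>(1)], of D 1] r by (simp add: \<mu> power_add)
      ultimately show ?thesis
        unfolding reducible_upto_def using r \<theta> \<beta>(1)
        by (intro exI[of _ "\<lambda>m'. if m' = m then mterm \<beta> 1 else 0"] exI[of _ 0])
          (auto simp: nb_0 standard_def)
    qed
    ultimately show ?thesis by (subst eq) (intro reducible_upto_add)
  qed
qed

text \<open>Only finitely many terms of h exceed \<open>\<theta> * B\<close>. Each is a scalar times
  a reducible monomial, and the rest already counts as error.\<close>

lemma reducible_upto_bound:
  assumes h: "h \<in> T D r" "nb D r B h" and B: "B > 0" shows "reducible_upto B h"
proof -
  define N where "N = {\<nu>. \<theta> * B \<le> v (coeff h \<nu>) * r ^ \<nu> D}"
  have finN: "finite N" unfolding N_def using h(1) \<theta> B by (intro T_finite) auto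
  have N: "\<nu> \<in> monomials D" if "\<nu> \<in> N" for \<nu>
  proof (rule ccontr)
    assume "\<nu> \<notin> monomials D"
    then have "coeff h \<nu> = 0" using T_coeff_outside[OF h(1)] by simp
    then show False using that \<theta> B by (simp add: N_def mult_le_0_iff)
  qed
  define h' where "h' = h - (\<Sum>\<nu>\<in>N. mterm \<nu> (coeff h \<nu>))"
  have "coeff h' \<alpha> = (if \<alpha> \<in> N then 0 else coeff h \<alpha>)" for \<alpha>
    unfolding h'_def coeff_diff using finN N monomials_finite_exp by (subst coeff_truncation) auto
  then have "nb D r (\<theta> * B) h'" using \<theta> B by (auto simp: nb_def N_def not_le)
  moreover have "h' \<in> T D r" unfolding h'_def using h(1) N by (intro T_diff T_sum r T_mterm) auto
  ultimately have "reducible_upto B h'" by (intro reducible_upto_small)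
  moreover have "reducible_upto B (\<Sum>\<nu>\<in>N. const (coeff h \<nu>) * mterm \<nu> 1)"
    using nbD[OF h(2)] N B by (intro reducible_upto_sum reducible_upto_scale[OF reducible_upto_mterm]) auto
  moreover have "(\<Sum>\<nu>\<in>N. const (coeff h \<nu>) * mterm \<nu> 1) = (\<Sum>\<nu>\<in>N. mterm \<nu> (coeff h \<nu>))"
    using N monomials_finite_exp by (intro sum.cong refl) (metis (no_types) mterm_mult finite_exp_zero add_0 mult.right_neutral)
  moreover have "h = (\<Sum>\<nu>\<in>N. mterm \<nu> (coeff h \<nu>)) + h'" by (simp add: h'_def)
  ultimately show ?thesis using reducible_upto_add by metis
qed

text \<open>Each round is applied to the error of the previous one, so quotients, remainders and
  errors decay geometrically. Being standard is a vanishing condition on single coefficients and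
  passes to the limit.\<close>

theorem division:
  assumes h: "h \<in> T D r"
  shows "\<exists>Q s. (\<forall>m\<in>F. Q m \<in> T D r) \<and> s \<in> T D r \<and> standard F s \<and> h = (\<Sum>m\<in>F. Q m * g m) + s"
proof -
  obtain B where B: "B > 0" "nb D r B h" using T_bounded[OF r h] by blast
  \<comment> \<open>The three outputs of a round are made functions of the pair (h, B), so that the
    successive errors can be defined by recursion.\<close>
  define good where "good h B t \<longleftrightarrow>
      (\<forall>m\<in>F. fst t m \<in> T D r \<and> nb D r (B / r ^ m D) (fst t m)) \<and> fst (snd t) \<in> T D r \<and>
      nb D r B (fst (snd t)) \<and> standard F (fst (snd t)) \<and> snd (snd t) \<in> T D r \<and>
      nb D r (\<theta> * B) (snd (snd t)) \<and> h = (\<Sum>m\<in>F. fst t m * g m) + fst (snd t) + snd (snd t)"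
    for h B and t :: "((nat \<Rightarrow> nat) \<Rightarrow> 'k mps) \<times> 'k mps \<times> 'k mps"
  define Qf where "Qf h B = fst (SOME t. good h B t)" for h B
  define sf where "sf h B = fst (snd (SOME t. good h B t))" for h B
  define hf where "hf h B = snd (snd (SOME t. good h B t))" for h B
  have step: "(\<forall>m\<in>F. Qf h B m \<in> T D r \<and> nb D r (B / r ^ m D) (Qf h B m)) \<and> sf h B \<in> T D r \<and>
      nb D r B (sf h B) \<and> standard F (sf h B) \<and> hf h B \<in> T D r \<and> nb D r (\<theta> * B) (hf h B) \<and>
      h = (\<Sum>m\<in>F. Qf h B m * g m) + sf h B + hf h B"
    if h: "h \<in> T D r" "nb D r B h" "B > 0" for h B
  proof -
    have "\<exists>t. good h B t"
      using reducible_upto_bound[OF h] unfolding reducible_upto_def good_def split_paired_Ex fst_conv snd_conv .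
    then have "good h B (SOME t. good h B t)" by (rule someI_ex)
    then show ?thesis unfolding good_def Qf_def sf_def hf_def .
  qed
  define hs where "hs = rec_nat h (\<lambda>n h'. hf h' (\<theta> ^ n * B))"
  have hs_0: "hs 0 = h" and hs_Suc: "hs (Suc n) = hf (hs n) (\<theta> ^ n * B)" for n
    by (simp_all add: hs_def)
  have pos: "\<theta> ^ n * B > 0" for n using \<theta> B by simp
  have hs: "hs n \<in> T D r \<and> nb D r (\<theta> ^ n * B) (hs n)" for n
  proof (induction n)
    case (Suc n)
    then show ?case using step[of "hs n" "\<theta> ^ n * B"] pos[of n] by (simp add: hs_Suc mult.assoc)
  qed (simp add: hs_0 h B)
  define Qs where "Qs n = Qf (hs n) (\<theta> ^ n * B)" for n
  define ss where "ss n = sf (hs n) (\<theta> ^ n * B)" for n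
  have *: "(\<forall>m\<in>F. Qs n m \<in> T D r \<and> nb D r (\<theta> ^ n * B / r ^ m D) (Qs n m)) \<and> ss n \<in> T D r \<and>
      nb D r (\<theta> ^ n * B) (ss n) \<and> standard F (ss n) \<and>
      hs n = (\<Sum>m\<in>F. Qs n m * g m) + ss n + hs (Suc n)" for n
    using step[of "hs n" "\<theta> ^ n * B"] hs pos[of n] by (simp add: hs_Suc Qs_def ss_def)
  have partial: "h = (\<Sum>m\<in>F. (\<Sum>n<N. Qs n m) * g m) + (\<Sum>n<N. ss n) + hs N" for N
  proof (induction N)
    case (Suc N)
    have "h = (\<Sum>m\<in>F. (\<Sum>n<N. Qs n m) * g m) + (\<Sum>n<N. ss n)
        + ((\<Sum>m\<in>F. Qs N m * g m) + ss N + hs (Suc N))"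
      using Suc.IH *[of N] by argo
    then show ?case by (simp add: distrib_right sum.distrib algebra_simps)
  qed (simp add: hs_0)
  have "\<forall>m\<in>F. \<exists>Q\<in>T D r. \<forall>N. nb D r (\<theta> ^ N * (B / r ^ m D)) (Q - (\<Sum>n<N. Qs n m))"
    using * \<theta> r by (intro ballI T_geometric_sum) auto
  then obtain Q where Q: "\<And>m. m \<in> F \<Longrightarrow> Q m \<in> T D r"
    "\<And>m N. m \<in> F \<Longrightarrow> nb D r (\<theta> ^ N * (B / r ^ m D)) (Q m - (\<Sum>n<N. Qs n m))"
    by metis
  obtain s where s: "s \<in> T D r" "\<And>N. nb D r (\<theta> ^ N * B) (s - (\<Sum>n<N. ss n))"
    using T_geometric_sum[OF r, of ss D \<theta> B] * \<theta> by blast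
  have zero: "coeff f \<alpha> = 0" if "\<And>N. v (coeff f \<alpha>) * r ^ \<alpha> D \<le> \<theta> ^ N * B" for f \<alpha>
  proof -
    have "v (coeff f \<alpha>) * r ^ \<alpha> D \<le> 0" using le_zero_of_geometric_bound[OF that \<theta>] .
    then have "v (coeff f \<alpha>) \<le> 0" using r zero_less_power[OF r, of "\<alpha> D"] by (simp add: mult_le_0_iff)
    then have "v (coeff f \<alpha>) = 0" using v_nonneg[of "coeff f \<alpha>"] by linarith
    then show ?thesis by simp
  qed
  have "standard F s"
    unfolding standard_def
  proof (intro allI ballI impI)
    fix \<alpha> m assume "m \<in> F" "m \<le> \<alpha>"
    then have "coeff (\<Sum>n<N. ss n) \<alpha> = 0" for N using * standardD by (simp, blast intro: sum.neutral)
    then show "coeff s \<alpha> = 0" using nbD[OF s(2), where \<alpha> = \<alpha>] by (intro zero) simp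
  qed
  moreover have "h = (\<Sum>m\<in>F. Q m * g m) + s"
  proof (rule mps_eqI)
    fix \<alpha>
    \<comment> \<open>Compared with the N-th partial identity, the defect of the limit identity has
      norm at most \<open>\<theta> ^ N * B\<close>, for every N.\<close>
    let ?E = "h - ((\<Sum>m\<in>F. Q m * g m) + s)"
    have "nb D r (\<theta> ^ N * B) ?E" for N
    proof -
      have "nb D r (\<theta> ^ N * B) ((Q m - (\<Sum>n<N. Qs n m)) * g m)" if "m \<in> F" for m
        using nb_mult[OF r Q(2)[OF that, of N] nb_g[OF that]] r by simp
      then have "nb D r (\<theta> ^ N * B)
          (hs N - (\<Sum>m\<in>F. (Q m - (\<Sum>n<N. Qs n m)) * g m) - (s - (\<Sum>n<N. ss n)))"
        using hs[of N] pos[of N] by (intro nb_diff[OF r nb_diff[OF r _ nb_sum[OF r]] s(2)]) auto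
      also have "hs N - (\<Sum>m\<in>F. (Q m - (\<Sum>n<N. Qs n m)) * g m) - (s - (\<Sum>n<N. ss n)) = ?E"
        by (subst partial[of N]) (simp add: left_diff_distrib sum_subtractf algebra_simps)
      finally show ?thesis .
    qed
    then have "coeff ?E \<alpha> = 0" using nbD[of D r _ ?E \<alpha>] by (intro zero) blast
    then show "coeff h \<alpha> = coeff ((\<Sum>m\<in>F. Q m * g m) + s) \<alpha>" by simp
  qed
  ultimately show ?thesis using Q(1) s(1) by blast
qed

end

end

section \<open>Weierstrass division by y - b, and units\<close>

definition unit_exp :: "nat \<Rightarrow> nat \<Rightarrow> nat" where
  "unit_exp D = (\<lambda>i. if i = D then 1 else 0)"

definition var :: "nat \<Rightarrow> 'k::comm_ring_1 mps" where
  "var D = mterm (unit_exp D) 1"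

lemma unit_exp_self [simp]: "unit_exp D D = 1"
  by (simp add: unit_exp_def)

lemma unit_exp_monomials [simp]: "unit_exp D \<in> monomials D"
  by (simp add: unit_exp_def monomials_def)

lemma finite_exp_unit_exp [simp]: "finite_exp (unit_exp D)"
  by (simp add: unit_exp_def finite_exp_def)

lemma unit_exp_le: "unit_exp D \<le> \<alpha> \<longleftrightarrow> \<alpha> D \<noteq> 0"
  by (auto simp: unit_exp_def le_fun_def)

lemma coeff_var: "coeff (var D) \<alpha> = (if \<alpha> = unit_exp D then 1 else 0)"
  by (simp add: var_def coeff_mterm)

lemma coeff_var_mult:
  "coeff (var D * f) \<alpha> = (if \<alpha> D \<noteq> 0 then coeff f (\<alpha> - unit_exp D) else 0)"
  by (simp add: var_def coeff_mterm_mult unit_exp_le)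

lemma coeff_var_mult_add [simp]: "coeff (var D * f) (unit_exp D + \<alpha>) = coeff f \<alpha>"
  by (simp add: var_def coeff_mterm_mult_add)

context nonarch_field
begin

lemma T_var [simp]: "r > 0 \<Longrightarrow> var D \<in> T D r"
  by (simp add: var_def)

lemma nb_var: "r > 0 \<Longrightarrow> nb D r r (var D)"
  using nb_mterm[of r "unit_exp D" D 1] by (simp add: var_def)

lemma free_of_const [simp]: "free_of D (const a)"
  by (auto simp: free_of_def coeff_const)

lemma free_of_1 [simp]: "free_of D 1"
  by (auto simp: free_of_def coeff_1)

lemma nb_const: "r > 0 \<Longrightarrow> v a \<le> B \<Longrightarrow> nb D r B (const a)"
  using nb_mono[OF nb_mterm[of r 0 D a]] by simp

text \<open>Comparing coefficients in positive y-degree, each coefficient of V is c times the one a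
  y-degree higher. As |c| \<le> r, the weights do not decrease along such a chain, which contradicts
  convergence unless they are 0. Hence y - c is no unit and remainders free of y are unique.\<close>

lemma linear_multiple_free:
  assumes r: "r > 0" and V: "V \<in> T D r" and c: "v c \<le> r"
    and free: "free_of D ((var D - const c) * V)"
  shows "V = 0"
proof (rule mps_eqI)
  fix \<alpha>
  have step: "coeff V \<beta> = c * coeff V (unit_exp D + \<beta>)" for \<beta>
  proof -
    have "coeff ((var D - const c) * V) (unit_exp D + \<beta>) = 0"
      using free by (simp add: free_of_def)
    then show ?thesis by (simp add: left_diff_distrib)
  qed
  define sh where "sh k = (\<lambda>i. if i = D then k + \<alpha> i else \<alpha> i)" for k :: nat
  have sh_Suc: "unit_exp D + sh k = sh (Suc k)" for k
    by (auto simp: sh_def unit_exp_def fun_eq_iff)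
  have sh_D: "sh k D = k + \<alpha> D" for k
    by (simp add: sh_def)
  then have inj: "inj sh" by (metis add_right_cancel injI)
  have it: "coeff V \<alpha> = c ^ k * coeff V (sh k)" for k
  proof (induction k)
    case (Suc k)
    then show ?case using step[of "sh k"] by (simp add: sh_Suc)
  next
    case 0
    have "sh 0 = \<alpha>" by (auto simp: sh_def)
    then show ?case by simp
  qed
  show "coeff V \<alpha> = coeff 0 \<alpha>"
  proof (rule ccontr)
    assume "coeff V \<alpha> \<noteq> coeff 0 \<alpha>"
    then have "v (coeff V \<alpha>) \<noteq> 0" by simp
    then have "v (coeff V \<alpha>) > 0" using v_nonneg[of "coeff V \<alpha>"] by linarith
    then have pos: "v (coeff V \<alpha>) * r ^ \<alpha> D > 0" using r by simp
    have "v (coeff V \<alpha>) * r ^ \<alpha> D \<le> v (coeff V (sh k)) * r ^ sh k D" for k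
    proof -
      have "v c ^ k \<le> r ^ k" using c by (simp add: power_mono)
      then have "v (coeff V \<alpha>) \<le> r ^ k * v (coeff V (sh k))"
        using it[of k] by (simp add: v_mult v_power mult_right_mono)
      then show ?thesis
        using mult_right_mono[of _ _ "r ^ \<alpha> D"] r by (simp add: sh_D power_add mult_ac)
    qed
    then have "range sh \<subseteq> {\<beta>. v (coeff V \<alpha>) * r ^ \<alpha> D \<le> v (coeff V \<beta>) * r ^ \<beta> D}" by blast
    then have "finite (range sh)" using T_finite[OF V pos] finite_subset by blast
    then show False using inj by (simp add: finite_image_iff)
  qed
qed

end

context complete_nonarch_field
begin

lemma linear_division:
  assumes r: "r > 0" and b: "b \<in> T D r" "free_of D b" "nb D r r b" and f: "f \<in> T D r"
  shows "\<exists>Q\<in>T D r. \<exists>s\<in>T D r. free_of D s \<and> f = (var D - b) * Q + s"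
proof -
  let ?g = "\<lambda>_ :: nat \<Rightarrow> nat. var D - b"
  have coeff: "coeff (var D - b) \<alpha> = (if \<alpha> = unit_exp D then 1 else 0)" if "\<alpha> D \<noteq> 0" for \<alpha>
    using b(2) that by (simp add: coeff_var free_of_def)
  have "\<exists>Q s. (\<forall>m\<in>{unit_exp D}. Q m \<in> T D r) \<and> s \<in> T D r \<and> standard {unit_exp D} s \<and>
      f = (\<Sum>m\<in>{unit_exp D}. Q m * ?g m) + s"
  \<comment> \<open>The leading monomial is y. All other monomials of y - b have y-degree 0 and so
    lie below it in the order by y-degree; nothing has to be small, and 1/2 is an arbitrary
    choice.\<close>
  proof (rule division[where \<theta> = "1/2" and ord = "measure (\<lambda>\<alpha>. \<alpha> D)"])
    show "nb D r (r ^ m D) (var D - b)" if "m \<in> {unit_exp D}" for m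
      using that r b(3) nb_diff[OF r nb_var[OF r] b(3)] by simp
    show "v (coeff (?g m) \<alpha>) * r ^ \<alpha> D \<le> 1/2 * r ^ m D"
      if "m \<in> {unit_exp D}" "\<alpha> \<noteq> m" "(\<alpha>, m) \<notin> measure (\<lambda>\<alpha>. \<alpha> D)" for m \<alpha>
      using that coeff[of \<alpha>] r by simp
  qed (use r b f coeff[of "unit_exp D"] in auto)
  then obtain Q s where "Q (unit_exp D) \<in> T D r" "s \<in> T D r" "standard {unit_exp D} s"
      "f = Q (unit_exp D) * (var D - b) + s"
    by auto
  moreover from this have "free_of D s" by (auto simp: free_of_def standard_def unit_exp_le)
  ultimately show ?thesis by (metis mult.commute)
qed

text \<open>The remainder takes the place of the value of f at y = c, so that no substitution into
  power series has to be defined.\<close>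

lemma evaluation_remainder:
  assumes "r > 0" "v c \<le> r" "f \<in> T D r"
  shows "\<exists>Q\<in>T D r. \<exists>s\<in>T D r. free_of D s \<and> f = (var D - const c) * Q + s"
  using assms by (intro linear_division nb_const) auto

text \<open>Division of 1 by g with leading monomial 1: only 0 is a standard remainder. All
  nonconstant terms are small, so the empty order suffices.\<close>

lemma unit_near_1:
  assumes r: "r > 0" and g: "g \<in> T D r" "coeff g 0 = 1"
    and small: "\<And>\<alpha>. \<alpha> \<noteq> 0 \<Longrightarrow> v (coeff g \<alpha>) * r ^ \<alpha> D \<le> \<theta>" and \<theta>: "0 < \<theta>" "\<theta> < 1"
  shows "\<exists>Q\<in>T D r. Q * g = 1"
proof -
  have "\<exists>Q s. (\<forall>m\<in>{0 :: nat \<Rightarrow> nat}. Q m \<in> T D r) \<and> s \<in> T D r \<and> standard {0} s \<and>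
      1 = (\<Sum>m\<in>{0}. Q m * g) + s"
  proof (rule division[where \<theta> = \<theta> and ord = "{}" and g = "\<lambda>_. g"])
    show "nb D r (r ^ m D) g" if "m \<in> {0}" for m
      unfolding nb_def
    proof
      fix \<alpha>
      show "v (coeff g \<alpha>) * r ^ \<alpha> D \<le> r ^ m D"
        using small[of \<alpha>] \<theta> g(2) that by (cases "\<alpha> = 0") auto
    qed
  qed (use r g \<theta> small in auto)
  then obtain Q s where "Q 0 \<in> T D r" "standard {0} s" "1 = Q 0 * g + s" by auto
  moreover from this have "s = 0" by (auto simp: mps_eq_iff standard_def)
  ultimately show ?thesis by auto
qed

text \<open>Division on the unit disc yields a second candidate U for the quotient. On the small
  disc (y - c)(W - U) is free of y, which forces W = U.\<close>

lemma linear_factor_descends: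
  assumes r: "0 < r" "r \<le> 1" and c: "v c \<le> r" and f: "f \<in> T D 1" and W: "W \<in> T D r"
    and eq: "f = (var D - const c) * W"
  shows "W \<in> T D 1"
proof -
  obtain U s where U: "U \<in> T D 1" "s \<in> T D 1" "free_of D s" "f = (var D - const c) * U + s"
    using evaluation_remainder[of 1 c f D] r c f by auto
  have "(var D - const c) * (W - U) = s" using eq U(4)
    by (metis add_diff_cancel_left' right_diff_distrib)
  moreover have "U \<in> T D r" using U(1) T_antimono[OF r] by blast
  ultimately have "W - U = 0"
    using U(3) W r c by (intro linear_multiple_free[of r _ D c]) auto
  with U(1) show ?thesis by simp
qed

end

section \<open>Leading monomials\<close>

text \<open>All lists have length \<open>D\<close>, so \<open>lenlex\<close> compares them
  lexicographically. The exponent of y is left out because leading monomials are read off at y =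
  0.\<close>

definition lex_exp :: "nat \<Rightarrow> ((nat \<Rightarrow> nat) \<times> (nat \<Rightarrow> nat)) set" where
  "lex_exp D = inv_image (lenlex less_than) (\<lambda>\<alpha>. map \<alpha> [0..<D])"

lemma wf_lex_exp: "wf (lex_exp D)"
  by (simp add: lex_exp_def wf_lenlex)

lemma lex_exp_add:
  assumes "(\<alpha>, \<beta>) \<in> lex_exp D" shows "(\<gamma> + \<alpha>, \<gamma> + \<beta>) \<in> lex_exp D"
proof -
  have "(map \<alpha> xs, map \<beta> xs) \<in> lenlex less_than \<Longrightarrow>
      (map (\<gamma> + \<alpha>) xs, map (\<gamma> + \<beta>) xs) \<in> lenlex less_than" for xs
    by (induction xs) (auto simp: Cons_lenlex_iff)
  with assms show ?thesis by (simp add: lex_exp_def)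
qed

text \<open>Consequently, if 1 is the leading monomial of a normalized series, every other term is
  small and the series is a unit on a small disc.\<close>

lemma not_lex_exp_0: "(\<alpha>, 0) \<notin> lex_exp D"
proof -
  have "(map \<alpha> xs, map 0 xs) \<notin> lenlex less_than" for xs
    by (induction xs) (auto simp: Cons_lenlex_iff)
  then show ?thesis by (simp add: lex_exp_def)
qed

lemma lex_exp_total:
  assumes "\<alpha> \<in> monomials D" "\<beta> \<in> monomials D" "\<alpha> D = 0" "\<beta> D = 0" "\<alpha> \<noteq> \<beta>"
  shows "(\<alpha>, \<beta>) \<in> lex_exp D \<or> (\<beta>, \<alpha>) \<in> lex_exp D"
proof -
  obtain i where i: "\<alpha> i \<noteq> \<beta> i" using assms(5) by (auto simp: fun_eq_iff)
  then have "i < D" using assms(1-4) unfolding monomials_def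
    by (metis (mono_tags, lifting) linorder_neqE_nat mem_Collect_eq)
  then have "map \<alpha> [0..<D] \<noteq> map \<beta> [0..<D]" using i by (auto simp: map_eq_conv)
  then show ?thesis
    using total_lenlex[OF total_less_than] by (auto simp: lex_exp_def total_on_def)
qed

lemma exists_lex_maximal:
  assumes "finite A" "A \<noteq> {}"
  shows "\<exists>m\<in>A. \<forall>\<alpha>\<in>A. (m, \<alpha>) \<notin> lex_exp D"
proof -
  let ?R = "lex_exp D \<inter> A \<times> A"
  have "wf (?R\<inverse>)"
    using assms(1) wf_lex_exp by (intro finite_acyclic_wf_converse wf_acyclic wf_Int1) auto
  then obtain m where "m \<in> A" "\<And>\<alpha>. (\<alpha>, m) \<in> ?R\<inverse> \<Longrightarrow> \<alpha> \<notin> A"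
    using assms(2) by (metis ex_in_conv wfE_min)
  then show ?thesis by blast
qed

text \<open>Induction on the number of compared coordinates. Let F0 serve for the first n of them
  and let N bound coordinate n on F0. Then F0 handles every exponent whose coordinate n is at least
  N; the finitely many slices below N are handled separately.\<close>

lemma dickson:
  fixes L :: "(nat \<Rightarrow> nat) set"
  shows "\<exists>F\<subseteq>L. finite F \<and> (\<forall>\<mu>\<in>L. \<exists>m\<in>F. \<forall>i<n. m i \<le> \<mu> i)"
proof (induction n arbitrary: L)
  case 0
  show ?case
  proof (cases "L = {}")
    case False
    then obtain m where "m \<in> L" by blast
    then show ?thesis by (intro exI[of _ "{m}"]) auto
  qed auto
next
  case (Suc n)
  obtain F0 where F0: "F0 \<subseteq> L" "finite F0" "\<forall>\<mu>\<in>L. \<exists>m\<in>F0. \<forall>i<n. m i \<le> \<mu> i"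
    using Suc.IH[of L] by blast
  have ex: "\<forall>k. \<exists>F. F \<subseteq> {\<mu>\<in>L. \<mu> n = k} \<and> finite F \<and> (\<forall>\<mu>\<in>{\<mu>\<in>L. \<mu> n = k}. \<exists>m\<in>F. \<forall>i<n. m i \<le> \<mu> i)"
    by (intro allI Suc.IH)
  obtain Fk where Fk': "\<forall>k. Fk k \<subseteq> {\<mu>\<in>L. \<mu> n = k} \<and> finite (Fk k) \<and>
      (\<forall>\<mu>\<in>{\<mu>\<in>L. \<mu> n = k}. \<exists>m\<in>Fk k. \<forall>i<n. m i \<le> \<mu> i)"
    by (rule exE[OF choice[OF ex]])
  then have Fk: "\<And>k. Fk k \<subseteq> {\<mu>\<in>L. \<mu> n = k}" "\<And>k. finite (Fk k)"
    "\<And>k \<mu>. \<mu> \<in> L \<Longrightarrow> \<mu> n = k \<Longrightarrow> \<exists>m\<in>Fk k. \<forall>i<n. m i \<le> \<mu> i"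
    by blast+
  obtain N where N: "\<And>m. m \<in> F0 \<Longrightarrow> m n \<le> N"
    using finite_nat_set_iff_bounded_le[of "(\<lambda>m. m n) ` F0"] F0(2) by auto
  let ?F = "F0 \<union> (\<Union>k<N. Fk k)"
  have "\<exists>m\<in>?F. \<forall>i<Suc n. m i \<le> \<mu> i" if \<mu>: "\<mu> \<in> L" for \<mu>
  proof (cases "\<mu> n < N")
    case True
    obtain m where m: "m \<in> Fk (\<mu> n)" "\<forall>i<n. m i \<le> \<mu> i" using Fk(3)[OF \<mu> refl] by blast
    then have "m n = \<mu> n" using Fk(1)[of "\<mu> n"] by blast
    with m True show ?thesis by (intro bexI[of _ m]) (auto simp: less_Suc_eq)
  next
    case False
    obtain m where m: "m \<in> F0" "\<forall>i<n. m i \<le> \<mu> i" using F0(3) \<mu> by blast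
    then show ?thesis using N[of m] False by (intro bexI[of _ m]) (auto simp: less_Suc_eq)
  qed
  moreover have "?F \<subseteq> L" using F0(1) Fk(1) by fast
  moreover have "finite ?F" using F0(2) Fk(2) by simp
  ultimately show ?case by blast
qed

section \<open>Leading monomials of f(x,0), and their persistence on a small disc\<close>

context complete_nonarch_field
begin

text \<open>Among the terms of maximal absolute value the lexicographically largest is chosen, so
  every other term is either lower in the order or strictly smaller in size. This is the alternative
  that division needs.\<close>

definition leading :: "nat \<Rightarrow> 'k mps \<Rightarrow> (nat \<Rightarrow> nat) \<Rightarrow> bool" where
  "leading D f m \<longleftrightarrow> m \<in> monomials D \<and> m D = 0 \<and> coeff f m \<noteq> 0 \<and>
     (\<forall>\<alpha>. \<alpha> D = 0 \<longrightarrow> \<alpha> \<noteq> m \<longrightarrow> v (coeff f \<alpha>) \<le> v (coeff f m) \<and>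
        ((\<alpha>, m) \<in> lex_exp D \<or> v (coeff f \<alpha>) < v (coeff f m)))"

lemma leading_exists:
  assumes f: "f \<in> T D 1" and \<beta>: "\<beta> D = 0" "coeff f \<beta> \<noteq> 0"
  shows "\<exists>m. leading D f m"
proof -
  define A where "A = {\<alpha>. \<alpha> D = 0 \<and> v (coeff f \<beta>) \<le> v (coeff f \<alpha>)}"
  have "finite {\<alpha>. v (coeff f \<beta>) \<le> v (coeff f \<alpha>) * 1 ^ \<alpha> D}"
    using \<beta>(2) by (intro T_finite[OF f]) simp
  then have finA: "finite A" by (rule finite_subset[rotated]) (auto simp: A_def)
  have \<beta>A: "\<beta> \<in> A" using \<beta> by (simp add: A_def)
  define M where "M = Max ((\<lambda>\<alpha>. v (coeff f \<alpha>)) ` A)"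
  have M: "v (coeff f \<alpha>) \<le> M" if "\<alpha> D = 0" for \<alpha>
  proof (cases "\<alpha> \<in> A")
    case True
    then show ?thesis unfolding M_def using finA by (intro Max_ge) auto
  next
    case False
    then have "v (coeff f \<alpha>) \<le> v (coeff f \<beta>)" using that by (simp add: A_def)
    also have "\<dots> \<le> M" unfolding M_def using finA \<beta>A by (intro Max_ge) auto
    finally show ?thesis .
  qed
  define A' where "A' = {\<alpha>\<in>A. v (coeff f \<alpha>) = M}"
  have "M \<in> (\<lambda>\<alpha>. v (coeff f \<alpha>)) ` A" unfolding M_def using finA \<beta>A by (intro Max_in) auto
  then have "A' \<noteq> {}" by (auto simp: A'_def)
  moreover have "finite A'" using finA by (simp add: A'_def)
  ultimately obtain m where m: "m \<in> A'" "\<And>\<alpha>. \<alpha> \<in> A' \<Longrightarrow> (m, \<alpha>) \<notin> lex_exp D"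
    using exists_lex_maximal[of A' D] by blast
  have nz: "coeff f \<alpha> \<noteq> 0" if "\<alpha> \<in> A" for \<alpha>
  proof
    assume "coeff f \<alpha> = 0"
    then have "v (coeff f \<beta>) \<le> 0" using that by (simp add: A_def)
    then show False using \<beta>(2) v_pos_iff[of "coeff f \<beta>"] by linarith
  qed
  have mon: "\<alpha> \<in> monomials D" if "\<alpha> \<in> A" for \<alpha>
    using T_coeff_outside[OF f, of \<alpha>] nz[OF that] by blast
  have mA: "m \<in> A" "v (coeff f m) = M" "m D = 0" using m(1) by (auto simp: A'_def A_def)
  have "(\<alpha>, m) \<in> lex_exp D \<or> v (coeff f \<alpha>) < v (coeff f m)" if "\<alpha> D = 0" "\<alpha> \<noteq> m" for \<alpha>
  proof (cases "v (coeff f \<alpha>) = M")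
    case True
    have "\<alpha> \<in> A" using that True mA by (simp add: A_def)
    then have "\<alpha> \<in> A'" using True by (simp add: A'_def)
    then show ?thesis
      using lex_exp_total[OF mon[OF \<open>\<alpha> \<in> A\<close>] mon[OF mA(1)]] that mA(3) m(2) by blast
  next
    case False
    then show ?thesis using M[of \<alpha>] that(1) mA(2) by simp
  qed
  then show ?thesis unfolding leading_def using mon[OF mA(1)] nz[OF mA(1)] mA(2,3) M by blast
qed

lemma leading_scale:
  assumes "leading D f m" "a \<noteq> 0" shows "leading D (const a * f) m"
  using assms by (simp add: leading_def v_mult)

text \<open>The terms of positive degree in the last variable become small on a small disc, so that
  the leading monomial of \<open>f\<close> at \<open>0\<close> governs \<open>f\<close> on the whole disc.\<close>

lemma leading_small_disc:
  assumes f: "f \<in> T D 1" and m: "leading D f m" "coeff f m = 1"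
  shows "\<exists>r0 \<theta>0. 0 < r0 \<and> r0 \<le> 1 \<and> 0 < \<theta>0 \<and> \<theta>0 < 1 \<and> (\<forall>r \<theta>. 0 < r \<longrightarrow> r \<le> r0 \<longrightarrow> \<theta>0 \<le> \<theta> \<longrightarrow>
    nb D r 1 f \<and> (\<forall>\<alpha>. \<alpha> \<noteq> m \<longrightarrow> (\<alpha>, m) \<notin> lex_exp D \<longrightarrow> v (coeff f \<alpha>) * r ^ \<alpha> D \<le> \<theta>))"
proof -
  obtain B where B: "B > 0" "nb D 1 B f" using T_bounded[OF _ f] by auto
  \<comment> \<open>For r \<le> r0 a term of positive y-degree has weight at most
    \<open>B * r0\<close>, hence at most 1/2.\<close>
  define r0 where "r0 = min 1 (1 / (2 * B))"
  have r0: "0 < r0" "r0 \<le> 1" "B * r0 \<le> 1/2"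
    using B(1) by (auto simp: r0_def min_def field_simps)
  \<comment> \<open>Values below 1 could accumulate at 1 in a dense value group. Only finitely many
    coefficients lie between 1/2 and 1, so their maximum, at least 1/2, still leaves a gap.\<close>
  define A where "A = {\<alpha>. 1/2 \<le> v (coeff f \<alpha>) \<and> v (coeff f \<alpha>) < 1}"
  have "finite {\<alpha>. 1/2 \<le> v (coeff f \<alpha>) * 1 ^ \<alpha> D}" by (intro T_finite[OF f]) simp
  then have finA: "finite A" by (rule finite_subset[rotated]) (auto simp: A_def)
  define \<theta>0 where "\<theta>0 = Max (insert (1/2) ((\<lambda>\<alpha>. v (coeff f \<alpha>)) ` A))"
  have "\<theta>0 \<in> insert (1/2) ((\<lambda>\<alpha>. v (coeff f \<alpha>)) ` A)" unfolding \<theta>0_def using finA by (intro Max_in) auto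
  then have \<theta>0: "\<theta>0 < 1" by (auto simp: A_def)
  have half: "1/2 \<le> \<theta>0" unfolding \<theta>0_def using finA by (intro Max_ge) auto
  have less: "v (coeff f \<alpha>) \<le> \<theta>0" if "v (coeff f \<alpha>) < 1" for \<alpha>
  proof (cases "\<alpha> \<in> A")
    case True
    then show ?thesis unfolding \<theta>0_def using finA by (intro Max_ge) auto
  next
    case False
    then show ?thesis using that half by (simp add: A_def)
  qed
  have high: "v (coeff f \<alpha>) * r ^ \<alpha> D \<le> 1/2" if r: "0 < r" "r \<le> r0" and "\<alpha> D \<noteq> 0" for r \<alpha>
  proof -
    have "r ^ \<alpha> D \<le> r ^ 1" using that r0(2) by (intro power_decreasing) auto
    then have "v (coeff f \<alpha>) * r ^ \<alpha> D \<le> B * r0"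
      using nbD[OF B(2), of \<alpha>] r B(1) by (intro mult_mono) auto
    then show ?thesis using r0(3) by linarith
  qed
  have "nb D r 1 f \<and> (\<forall>\<alpha>. \<alpha> \<noteq> m \<longrightarrow> (\<alpha>, m) \<notin> lex_exp D \<longrightarrow> v (coeff f \<alpha>) * r ^ \<alpha> D \<le> \<theta>)"
    if r: "0 < r" "r \<le> r0" and \<theta>: "\<theta>0 \<le> \<theta>" for r \<theta>
  proof
    have "v (coeff f \<alpha>) * r ^ \<alpha> D \<le> 1" for \<alpha>
    proof (cases "\<alpha> D = 0")
      case True
      then show ?thesis using m by (cases "\<alpha> = m") (auto simp: leading_def)
    next
      case False
      then show ?thesis using high[of r \<alpha>] r False by simp
    qed
    then show "nb D r 1 f" by (simp add: nb_def)
    show "\<forall>\<alpha>. \<alpha> \<noteq> m \<longrightarrow> (\<alpha>, m) \<notin> lex_exp D \<longrightarrow> v (coeff f \<alpha>) * r ^ \<alpha> D \<le> \<theta>"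
    proof (intro allI impI)
      fix \<alpha> assume \<alpha>: "\<alpha> \<noteq> m" "(\<alpha>, m) \<notin> lex_exp D"
      show "v (coeff f \<alpha>) * r ^ \<alpha> D \<le> \<theta>"
      proof (cases "\<alpha> D = 0")
        case True
        then have "v (coeff f \<alpha>) < 1" using m \<alpha> by (auto simp: leading_def)
        then show ?thesis using less[of \<alpha>] True \<theta> by simp
      next
        case False
        then show ?thesis using high[of r \<alpha>] r False half \<theta> by simp
      qed
    qed
  qed
  moreover have "0 < \<theta>0" using half by simp
  ultimately show ?thesis using r0(1,2) \<theta>0 by blast
qed

section \<open>Saturated ideals and standard bases\<close>

definition is_ideal :: "nat \<Rightarrow> 'k mps set \<Rightarrow> bool" where
  "is_ideal D I \<longleftrightarrow> I \<subseteq> T D 1 \<and> 0 \<in> I \<and> (\<forall>f\<in>I. \<forall>g\<in>I. f + g \<in> I) \<and> (\<forall>q\<in>T D 1. \<forall>f\<in>I. q * f \<in> I)"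

lemma is_idealD:
  assumes "is_ideal D I"
  shows "f \<in> I \<Longrightarrow> f \<in> T D 1" "0 \<in> I" "f \<in> I \<Longrightarrow> g \<in> I \<Longrightarrow> f + g \<in> I"
    "q \<in> T D 1 \<Longrightarrow> f \<in> I \<Longrightarrow> q * f \<in> I"
  using assms by (auto simp: is_ideal_def)

lemma is_ideal_sum: "is_ideal D I \<Longrightarrow> (\<And>i. i \<in> A \<Longrightarrow> f i \<in> I) \<Longrightarrow> sum f A \<in> I"
  by (induction A rule: infinite_finite_induct) (auto simp: is_idealD)

definition trivial_at :: "nat \<Rightarrow> 'k mps set \<Rightarrow> 'k \<Rightarrow> bool" where
  "trivial_at D I c \<longleftrightarrow> (\<exists>H\<in>I. \<exists>U\<in>T D 1. 1 = H + (var D - const c) * U)"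

context
  fixes D :: nat and J :: "'k mps set"
  assumes J: "is_ideal D J"
    and sat: "\<And>f. f \<in> T D 1 \<Longrightarrow> var D * f \<in> J \<Longrightarrow> f \<in> J"
begin

definition LM :: "(nat \<Rightarrow> nat) set" where
  "LM = {m. \<exists>f\<in>J. leading D f m}"

text \<open>Division by y - 0 leaves the y-free part of f, which vanishes when N > 0; saturation
  keeps the quotient in J. After N rounds the terms of y-degree N have become those of y-degree
  0.\<close>

lemma divide_var_power:
  "f \<in> J \<Longrightarrow> (\<And>\<alpha>. \<alpha> D < N \<Longrightarrow> coeff f \<alpha> = 0) \<Longrightarrow>
    \<exists>h\<in>J. \<forall>\<alpha>. \<alpha> D = 0 \<longrightarrow> coeff h \<alpha> = coeff f (\<alpha> + (\<lambda>i. if i = D then N else 0))"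
proof (induction N arbitrary: f)
  case 0
  have "(\<lambda>i. if i = D then 0 else 0) = (0 :: nat \<Rightarrow> nat)" by auto
  with 0 show ?case by (intro bexI[of _ f]) (simp_all only: add_0_right simp_thms)
next
  case (Suc N)
  have fT: "f \<in> T D 1" using Suc.prems(1) is_idealD(1)[OF J] by blast
  obtain Q s where Q: "Q \<in> T D 1" "free_of D s" "f = (var D - const 0) * Q + s"
    using evaluation_remainder[of 1 0 f D] fT by auto
  have f: "f = var D * Q + s" using Q(3) by (simp add: const_0)
  have "s = 0"
  proof (rule mps_eqI)
    fix \<alpha>
    show "coeff s \<alpha> = coeff 0 \<alpha>"
      using Suc.prems(2)[of \<alpha>] Q(2) f
      by (cases "\<alpha> D = 0") (auto simp: coeff_var_mult free_of_def)
  qed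
  then have "var D * Q = f" using f by simp
  then have QJ: "Q \<in> J" using sat Q(1) Suc.prems(1) by blast
  have Qf: "coeff Q \<alpha> = coeff f (unit_exp D + \<alpha>)" for \<alpha> using \<open>var D * Q = f\<close> by auto
  then have "coeff Q \<alpha> = 0" if "\<alpha> D < N" for \<alpha> using that Suc.prems(2) by simp
  then obtain h where h: "h \<in> J"
    "\<And>\<alpha>. \<alpha> D = 0 \<Longrightarrow> coeff h \<alpha> = coeff Q (\<alpha> + (\<lambda>i. if i = D then N else 0))"
    using Suc.IH[OF QJ] by blast
  have "unit_exp D + (\<alpha> + (\<lambda>i. if i = D then N else 0)) = \<alpha> + (\<lambda>i. if i = D then Suc N else 0)" for \<alpha>
    by (auto simp: unit_exp_def fun_eq_iff)
  then have "coeff h \<alpha> = coeff f (\<alpha> + (\<lambda>i. if i = D then Suc N else 0))" if "\<alpha> D = 0" for \<alpha>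
    using h(2)[of \<alpha>] that by (simp only: Qf)
  then show ?case using h(1) by blast
qed

lemma standard_basis_exists:
  "\<exists>G g r \<theta>. finite G \<and> G \<subseteq> LM \<and> (\<forall>\<mu>\<in>LM. \<exists>m\<in>G. m \<le> \<mu>) \<and> 0 < r \<and> r \<le> 1 \<and> 0 < \<theta> \<and> \<theta> < 1 \<and>
    (\<forall>m\<in>G. g m \<in> J \<and> coeff (g m) m = 1 \<and> nb D r 1 (g m) \<and>
      (\<forall>\<alpha>. \<alpha> \<noteq> m \<longrightarrow> (\<alpha>, m) \<notin> lex_exp D \<longrightarrow> v (coeff (g m) \<alpha>) * r ^ \<alpha> D \<le> \<theta>))"
proof -
  obtain G where G: "G \<subseteq> LM" "finite G" "\<forall>\<mu>\<in>LM. \<exists>m\<in>G. \<forall>i<D. m i \<le> \<mu> i"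
    using dickson[of LM D] by blast
  \<comment> \<open>Dickson's lemma compares only the exponents of x; all other entries of a leading
    monomial are 0.\<close>
  have zero: "m i = 0" if "m \<in> LM" "\<not> i < D" for m i
  proof -
    have "m \<in> monomials D" "m D = 0" using that(1) by (auto simp: LM_def leading_def)
    then show ?thesis using that(2) by (cases "i = D") (auto simp: monomials_def)
  qed
  have cover: "\<forall>\<mu>\<in>LM. \<exists>m\<in>G. m \<le> \<mu>"
  proof
    fix \<mu> assume "\<mu> \<in> LM"
    obtain m where m: "m \<in> G" "\<forall>i<D. m i \<le> \<mu> i" using G(3) \<open>\<mu> \<in> LM\<close> by blast
    have "m \<in> LM" using m(1) G(1) by blast
    then have "m i \<le> \<mu> i" for i using m(2) zero[of m i] by (cases "i < D") simp_all
    then show "\<exists>m\<in>G. m \<le> \<mu>" using m(1) by (auto simp: le_fun_def)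
  qed
  have "\<forall>m\<in>G. \<exists>g. g \<in> J \<and> leading D g m \<and> coeff g m = 1"
  proof
    fix m assume "m \<in> G"
    then obtain f where f: "f \<in> J" "leading D f m" using G(1) by (auto simp: LM_def)
    then have "coeff f m \<noteq> 0" by (simp add: leading_def)
    then show "\<exists>g. g \<in> J \<and> leading D g m \<and> coeff g m = 1"
      using f by (intro exI[of _ "const (1 / coeff f m) * f"]) (simp add: leading_scale is_idealD(4)[OF J])
  qed
  then obtain g where g: "\<forall>m\<in>G. g m \<in> J \<and> leading D (g m) m \<and> coeff (g m) m = 1"
    by (rule exE[OF bchoice])
  have "\<forall>m\<in>G. \<exists>rt :: real \<times> real. 0 < fst rt \<and> fst rt \<le> 1 \<and> 0 < snd rt \<and> snd rt < 1 \<and>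
    (\<forall>r \<theta>. 0 < r \<longrightarrow> r \<le> fst rt \<longrightarrow> snd rt \<le> \<theta> \<longrightarrow> nb D r 1 (g m) \<and>
      (\<forall>\<alpha>. \<alpha> \<noteq> m \<longrightarrow> (\<alpha>, m) \<notin> lex_exp D \<longrightarrow> v (coeff (g m) \<alpha>) * r ^ \<alpha> D \<le> \<theta>))"
  proof
    fix m assume m: "m \<in> G"
    have "g m \<in> T D 1" "leading D (g m) m" "coeff (g m) m = 1"
      using g m is_idealD(1)[OF J] by blast+
    from leading_small_disc[OF this]
    show "\<exists>rt :: real \<times> real. 0 < fst rt \<and> fst rt \<le> 1 \<and> 0 < snd rt \<and> snd rt < 1 \<and>
      (\<forall>r \<theta>. 0 < r \<longrightarrow> r \<le> fst rt \<longrightarrow> snd rt \<le> \<theta> \<longrightarrow> nb D r 1 (g m) \<and>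
        (\<forall>\<alpha>. \<alpha> \<noteq> m \<longrightarrow> (\<alpha>, m) \<notin> lex_exp D \<longrightarrow> v (coeff (g m) \<alpha>) * r ^ \<alpha> D \<le> \<theta>))"
      unfolding split_paired_Ex fst_conv snd_conv .
  qed
  then obtain rt :: "(nat \<Rightarrow> nat) \<Rightarrow> real \<times> real" where rt: "\<forall>m\<in>G. 0 < fst (rt m) \<and> fst (rt m) \<le> 1 \<and> 0 < snd (rt m) \<and>
    snd (rt m) < 1 \<and> (\<forall>r \<theta>. 0 < r \<longrightarrow> r \<le> fst (rt m) \<longrightarrow> snd (rt m) \<le> \<theta> \<longrightarrow> nb D r 1 (g m) \<and>
      (\<forall>\<alpha>. \<alpha> \<noteq> m \<longrightarrow> (\<alpha>, m) \<notin> lex_exp D \<longrightarrow> v (coeff (g m) \<alpha>) * r ^ \<alpha> D \<le> \<theta>))"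
    by (rule exE[OF bchoice])
  \<comment> \<open>\<open>leading_small_disc\<close> remains valid for smaller r and larger
    \<open>\<theta>\<close>, so finitely many series can share both constants.\<close>
  define r where "r = Min (insert 1 ((fst \<circ> rt) ` G))"
  define \<theta> where "\<theta> = Max (insert (1/2) ((snd \<circ> rt) ` G))"
  have "r \<in> insert 1 ((fst \<circ> rt) ` G)" unfolding r_def using G(2) by (intro Min_in) auto
  then have r: "0 < r" using rt by auto
  have r1: "r \<le> 1" unfolding r_def using G(2) by (intro Min_le) auto
  have rm: "r \<le> fst (rt m)" if "m \<in> G" for m unfolding r_def using G(2) that by (intro Min_le) auto
  have "\<theta> \<in> insert (1/2) ((snd \<circ> rt) ` G)" unfolding \<theta>_def using G(2) by (intro Max_in) auto
  then have \<theta>: "0 < \<theta>" "\<theta> < 1" using rt by auto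
  have \<theta>m: "snd (rt m) \<le> \<theta>" if "m \<in> G" for m unfolding \<theta>_def using G(2) that by (intro Max_ge) auto
  have "\<forall>m\<in>G. g m \<in> J \<and> coeff (g m) m = 1 \<and> nb D r 1 (g m) \<and>
      (\<forall>\<alpha>. \<alpha> \<noteq> m \<longrightarrow> (\<alpha>, m) \<notin> lex_exp D \<longrightarrow> v (coeff (g m) \<alpha>) * r ^ \<alpha> D \<le> \<theta>)"
    using g rt r rm \<theta>m by blast
  then show ?thesis using G(1,2) cover r r1 \<theta>
    by - (rule exI[of _ G], rule exI[of _ g], rule exI[of _ r], rule exI[of _ \<theta>], intro conjI)
qed

end

end

section \<open>Truncation in y, and the fibres near 0\<close>

context complete_nonarch_field
begin

definition cutoff :: "nat \<Rightarrow> nat \<Rightarrow> 'k mps \<Rightarrow> 'k mps" where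
  "cutoff D N f = Abs_mps (\<lambda>\<alpha>. if \<alpha> D \<le> N then coeff f \<alpha> else 0)"

lemma coeff_cutoff: "coeff (cutoff D N f) \<alpha> = (if \<alpha> D \<le> N then coeff f \<alpha> else 0)"
proof -
  have "(\<lambda>\<alpha>. if \<alpha> D \<le> N then coeff f \<alpha> else 0) \<in> {f. \<forall>\<alpha>. \<not> finite_exp \<alpha> \<longrightarrow> f \<alpha> = 0}"
    by (simp add: coeff_infinite)
  then show ?thesis by (simp add: cutoff_def Abs_mps_inverse)
qed

text \<open>In y-degree at most N the weights for the radii r and 1 differ by a factor no worse than
  \<open>r ^ N\<close>, so truncation leads back to the unit disc.\<close>

lemma cutoff_T:
  assumes r: "0 < r" "r \<le> 1" and f: "f \<in> T D r"
  shows "cutoff D N f \<in> T D 1"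
proof (rule TI)
  fix e :: real assume e: "e > 0"
  have "{\<alpha>. e \<le> v (coeff (cutoff D N f) \<alpha>) * 1 ^ \<alpha> D}
      \<subseteq> {\<alpha>. e * r ^ N \<le> v (coeff f \<alpha>) * r ^ \<alpha> D}"
  proof
    fix \<alpha> assume "\<alpha> \<in> {\<alpha>. e \<le> v (coeff (cutoff D N f) \<alpha>) * 1 ^ \<alpha> D}"
    then have \<alpha>: "\<alpha> D \<le> N" "e \<le> v (coeff f \<alpha>)" using e by (auto simp: coeff_cutoff split: if_splits)
    then have "e * r ^ N \<le> v (coeff f \<alpha>) * r ^ \<alpha> D"
      using r e by (intro mult_mono power_decreasing) auto
    then show "\<alpha> \<in> {\<alpha>. e * r ^ N \<le> v (coeff f \<alpha>) * r ^ \<alpha> D}" by simp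
  qed
  then show "finite {\<alpha>. e \<le> v (coeff (cutoff D N f) \<alpha>) * 1 ^ \<alpha> D}"
    by (rule finite_subset) (intro T_finite[OF f] mult_pos_pos e zero_less_power r)
qed (use T_coeff_outside[OF f] in \<open>simp add: coeff_cutoff\<close>)

lemma coeff_cutoff_mult:
  assumes "\<alpha> D \<le> N" shows "coeff (cutoff D N f * g) \<alpha> = coeff (f * g) \<alpha>"
proof (cases "finite_exp \<alpha>")
  case True
  have "coeff (cutoff D N f) \<beta> = coeff f \<beta>" if "(\<beta>, \<gamma>) \<in> splits \<alpha>" for \<beta> \<gamma>
    using that assms by (auto simp: splits_def coeff_cutoff)
  then show ?thesis unfolding coeff_mult[OF True] by (intro sum.cong) auto
qed (simp add: coeff_infinite)

text \<open>The quotients converge only on the small disc, so s need not lie in J. Its lowest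
  y-coefficient is nevertheless the value at y = 0 of an element h of J. The leading monomial of h
  is divisible by a member of G, although s is standard.\<close>

lemma standard_combination_eq_0:
  assumes J: "is_ideal D J" and sat: "\<And>f. f \<in> T D 1 \<Longrightarrow> var D * f \<in> J \<Longrightarrow> f \<in> J"
    and cover: "\<And>\<mu>. \<mu> \<in> LM D J \<Longrightarrow> \<exists>m\<in>G. m \<le> \<mu>" and g: "\<And>m. m \<in> G \<Longrightarrow> g m \<in> J"
    and r: "0 < r" "r \<le> 1" and H: "H \<in> J" and Q: "\<And>m. m \<in> G \<Longrightarrow> Q m \<in> T D r"
    and s: "s = H + (\<Sum>m\<in>G. Q m * g m)" "standard G s"
  shows "s = 0"
proof (rule ccontr)
  assume "s \<noteq> 0"
  then have ex: "\<exists>n \<alpha>. coeff s \<alpha> \<noteq> 0 \<and> \<alpha> D = n" by (auto simp: mps_eq_iff)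
  define N where "N = (LEAST n. \<exists>\<alpha>. coeff s \<alpha> \<noteq> 0 \<and> \<alpha> D = n)"
  obtain \<alpha> where \<alpha>: "coeff s \<alpha> \<noteq> 0" "\<alpha> D = N"
    using LeastI_ex[OF ex] unfolding N_def by blast
  have below: "coeff s \<beta> = 0" if "\<beta> D < N" for \<beta>
    using not_less_Least[of "\<beta> D" "\<lambda>n. \<exists>\<alpha>. coeff s \<alpha> \<noteq> 0 \<and> \<alpha> D = n"] that unfolding N_def by blast
  \<comment> \<open>Coefficients up to y-degree N do not see the truncation, so f agrees with s
    there while lying in J.\<close>
  define f where "f = H + (\<Sum>m\<in>G. cutoff D N (Q m) * g m)"
  have fJ: "f \<in> J"
    unfolding f_def using H g Q r by (intro is_idealD(3)[OF J] is_ideal_sum[OF J] is_idealD(4)[OF J] cutoff_T) auto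
  have fs: "coeff f \<beta> = coeff s \<beta>" if "\<beta> D \<le> N" for \<beta>
    using that by (simp add: f_def s(1) coeff_cutoff_mult)
  obtain h where h: "h \<in> J" "\<forall>\<beta>. \<beta> D = 0 \<longrightarrow> coeff h \<beta> = coeff f (\<beta> + (\<lambda>i. if i = D then N else 0))"
    using divide_var_power[OF J sat fJ, of N] fs below by auto
  have hs: "coeff h \<beta> = coeff s (\<beta> + (\<lambda>i. if i = D then N else 0))" if "\<beta> D = 0" for \<beta>
    using h(2) that fs[of "\<beta> + (\<lambda>i. if i = D then N else 0)"] by simp
  define \<beta> where "\<beta> = (\<lambda>i. if i = D then 0 else \<alpha> i)"
  have "\<beta> + (\<lambda>i. if i = D then N else 0) = \<alpha>" using \<alpha>(2) by (auto simp: \<beta>_def fun_eq_iff)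
  then have "coeff h \<beta> \<noteq> 0" using hs[of \<beta>] \<alpha>(1) by (simp add: \<beta>_def)
  moreover have "\<beta> D = 0" by (simp add: \<beta>_def)
  ultimately obtain \<mu> where \<mu>: "leading D h \<mu>"
    using leading_exists[of h D \<beta>] h(1) is_idealD(1)[OF J] by blast
  then have "\<mu> \<in> LM D J" using h(1) by (auto simp: LM_def[OF J sat])
  then obtain m where m: "m \<in> G" "m \<le> \<mu>" using cover by blast
  have "m \<le> \<mu> + (\<lambda>i. if i = D then N else 0)" using m(2) exp_le_add(1) order_trans by blast
  then have "coeff h \<mu> = 0" using hs[of \<mu>] \<mu> standardD[OF s(2) m(1)] by (simp add: leading_def)
  then show False using \<mu> by (simp add: leading_def)
qed

text \<open>Near \<open>0\<close>, the fibres of \<open>T/I\<close> away from \<open>0\<close> are those of the \<open>y\<close>-saturation \<open>J\<close>. If \<open>1\<close>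
  is a leading monomial of \<open>J\<close>, then \<open>J\<close> contains a unit on a small disc. Otherwise division by a
  standard basis shows that \<open>T/J\<close> is a nonzero topologically free module over the disc.\<close>

theorem trivial_at_near_0:
  assumes I: "is_ideal D I"
  shows "\<exists>\<epsilon>>0. \<epsilon> \<le> 1 \<and> ((\<forall>c. c \<noteq> 0 \<longrightarrow> v c \<le> \<epsilon> \<longrightarrow> trivial_at D I c) \<or> (\<forall>c. v c \<le> \<epsilon> \<longrightarrow> \<not> trivial_at D I c))"
proof -
  let ?y = "var D :: 'k mps"
  define J where "J = {f \<in> T D 1. \<exists>N. ?y ^ N * f \<in> I}"
  have yT: "?y ^ N \<in> T D 1" for N by simp
  have J: "is_ideal D J"
    unfolding is_ideal_def
  proof (intro conjI ballI)
    show "J \<subseteq> T D 1" by (auto simp: J_def)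
    show "0 \<in> J" using is_idealD(2)[OF I] by (auto simp: J_def)
    show "f + g \<in> J" if fg: "f \<in> J" "g \<in> J" for f g
    proof -
      obtain M N where MN: "f \<in> T D 1" "g \<in> T D 1" "?y ^ M * f \<in> I" "?y ^ N * g \<in> I"
        using fg by (auto simp: J_def)
      have "?y ^ N * (?y ^ M * f) + ?y ^ M * (?y ^ N * g) \<in> I"
        by (rule is_idealD(3)[OF I is_idealD(4)[OF I yT MN(3)] is_idealD(4)[OF I yT MN(4)]])
      also have "?y ^ N * (?y ^ M * f) + ?y ^ M * (?y ^ N * g) = ?y ^ (N + M) * (f + g)"
        by (simp add: power_add algebra_simps)
      finally show ?thesis using MN by (auto simp: J_def)
    qed
    show "q * f \<in> J" if qf: "q \<in> T D 1" "f \<in> J" for q f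
    proof -
      obtain N where N: "f \<in> T D 1" "?y ^ N * f \<in> I" using qf by (auto simp: J_def)
      then have "q * (?y ^ N * f) \<in> I" using qf(1) is_idealD(4)[OF I] by blast
      also have "q * (?y ^ N * f) = ?y ^ N * (q * f)" by (simp add: mult_ac)
      finally show ?thesis using N qf by (auto simp: J_def)
    qed
  qed
  have sat: "f \<in> J" if f: "f \<in> T D 1" "?y * f \<in> J" for f
  proof -
    obtain N where "?y ^ N * (?y * f) \<in> I" using f by (auto simp: J_def)
    then have "?y ^ Suc N * f \<in> I" by (simp only: power_Suc mult_ac)
    then show ?thesis using f unfolding J_def by blast
  qed
  note LM_def = LM_def[OF J sat]
  obtain G g r \<theta> where G: "finite G" "G \<subseteq> LM D J" "\<forall>\<mu>\<in>LM D J. \<exists>m\<in>G. m \<le> \<mu>"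
    and r: "0 < r" "r \<le> 1" and \<theta>: "0 < \<theta>" "\<theta> < 1"
    and g': "\<forall>m\<in>G. g m \<in> J \<and> coeff (g m) m = 1 \<and> nb D r 1 (g m) \<and>
      (\<forall>\<alpha>. \<alpha> \<noteq> m \<longrightarrow> (\<alpha>, m) \<notin> lex_exp D \<longrightarrow> v (coeff (g m) \<alpha>) * r ^ \<alpha> D \<le> \<theta>)"
    using standard_basis_exists[OF J sat] by blast
  have g: "g m \<in> J" "coeff (g m) m = 1" "nb D r 1 (g m)"
    "\<And>\<alpha>. \<alpha> \<noteq> m \<Longrightarrow> (\<alpha>, m) \<notin> lex_exp D \<Longrightarrow> v (coeff (g m) \<alpha>) * r ^ \<alpha> D \<le> \<theta>" if "m \<in> G" for m
    using g' that by auto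
  have gT: "g m \<in> T D 1" "g m \<in> T D r" if "m \<in> G" for m
    using is_idealD(1)[OF J g(1)[OF that]] T_antimono[OF r] by blast+
  have Gm: "m \<in> monomials D" "m D = 0" if "m \<in> G" for m
    using G(2) that by (auto simp: LM_def leading_def)
  show ?thesis
  proof (cases "0 \<in> G")
    case True
    obtain Q where Q: "Q \<in> T D r" "Q * g 0 = 1"
      using unit_near_1[OF r(1) gT(2)[OF True] g(2)[OF True] _ \<theta>] g(4)[OF True] not_lex_exp_0 by blast
    obtain N where N: "?y ^ N * g 0 \<in> I" using g(1)[OF True] by (auto simp: J_def)
    have "trivial_at D I c" if c: "c \<noteq> 0" "v c \<le> r" for c
    proof -
      obtain P q where P: "P \<in> T D r" "q \<in> T D r" "free_of D q" "Q = (?y - const c) * P + q"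
        using evaluation_remainder[OF r(1) c(2) Q(1)] by blast
      \<comment> \<open>Being free of y, the value of the inverse at y = c extends from the small
        disc to the unit disc.\<close>
      have q: "q \<in> T D 1" using free_of_weight[OF P(3,2)] .
      define W where "W = P * g 0"
      have "((?y - const c) * P + q) * g 0 = 1" using Q(2) P(4) by simp
      then have W: "1 - q * g 0 = (?y - const c) * W"
        by (simp add: W_def algebra_simps)
      have "W \<in> T D 1"
        by (rule linear_factor_descends[OF r c(2) _ _ W])
          (use r q gT[OF True] P(1) in \<open>auto simp: W_def\<close>)
      \<comment> \<open>E is the quotient of y^N - c^N by y - c. It exchanges \<open>g 0\<close>,
        known only to lie in J, for \<open>y ^ N * g 0\<close> in I at the cost of dividing by c^N;
        this is where c \<noteq> 0 enters.\<close>
      define E where "E = (\<Sum>i<N. const c ^ (N - Suc i) * ?y ^ i)"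
      have E: "?y ^ N - const c ^ N = (?y - const c) * E" unfolding E_def by (rule power_diff_sumr2)
      have ET: "E \<in> T D 1" unfolding E_def by (intro T_sum T_mult T_power) auto
      define k where "k = const (inverse (c ^ N))"
      have k: "k * const c ^ N = 1"
        using c(1) by (simp add: k_def const_power[symmetric] const_mult[symmetric] const_1)
      define H where "H = (k * q) * (?y ^ N * g 0)"
      define U where "U = k * (?y ^ N * W - E)"
      have "H \<in> I" unfolding H_def using q by (intro is_idealD(4)[OF I _ N] T_mult) (auto simp: k_def)
      moreover have "U \<in> T D 1" unfolding U_def using ET \<open>W \<in> T D 1\<close>
        by (intro T_mult T_diff T_power) (auto simp: k_def)
      moreover have "1 = H + (?y - const c) * U"
      proof -
        have "H = k * ?y ^ N * (q * g 0)" by (simp add: H_def mult_ac)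
        also have "q * g 0 = 1 - (?y - const c) * W" using W by (simp add: algebra_simps)
        finally have "H + (?y - const c) * U = k * (?y ^ N - (?y - const c) * E)"
          by (simp add: U_def algebra_simps)
        also have "\<dots> = k * const c ^ N" by (simp add: E[symmetric])
        finally show ?thesis using k by simp
      qed
      ultimately show ?thesis unfolding trivial_at_def by blast
    qed
    then show ?thesis using r by blast
  next
    case False
    have "\<not> trivial_at D I c" if c: "v c \<le> r" for c
    proof
      assume "trivial_at D I c"
      then obtain H U where H: "H \<in> I" and U: "U \<in> T D 1" and eq: "1 = H + (?y - const c) * U"
        unfolding trivial_at_def by blast
      have "?y ^ 0 * H \<in> I" using H by simp
      then have HJ: "H \<in> J" using is_idealD(1)[OF I H] unfolding J_def by blast
      have "\<exists>Q s. (\<forall>m\<in>G. Q m \<in> T D r) \<and> s \<in> T D r \<and> standard G s \<and> U = (\<Sum>m\<in>G. Q m * g m) + s"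
      proof (rule division[where \<theta> = \<theta> and ord = "lex_exp D"])
        show "U \<in> T D r" using U T_antimono[OF r] by blast
        show "nb D r (r ^ m D) (g m)" if "m \<in> G" for m using g(3)[OF that] Gm[OF that] by simp
        show "v (coeff (g m) \<alpha>) * r ^ \<alpha> D \<le> \<theta> * r ^ m D"
          if "m \<in> G" "\<alpha> \<noteq> m" "(\<alpha>, m) \<notin> lex_exp D" for m \<alpha>
          using g(4)[OF that] Gm[OF that(1)] by simp
      qed (use r \<theta> G(1) Gm gT g(2) wf_lex_exp lex_exp_add in auto)
      then obtain Q s where Q: "\<And>m. m \<in> G \<Longrightarrow> Q m \<in> T D r" and s: "s \<in> T D r" "standard G s"
        and Us: "U = (\<Sum>m\<in>G. Q m * g m) + s" by blast
      define s' where "s' = 1 - (?y - const c) * s"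
      have "s' = H + (\<Sum>m\<in>G. ((?y - const c) * Q m) * g m)"
      proof -
        have "s' = H + (?y - const c) * (U - s)" unfolding s'_def
          by (subst eq) (simp add: algebra_simps)
        then show ?thesis by (simp add: Us sum_distrib_left mult.assoc)
      qed
      \<comment> \<open>The monomials in G are free of y, so multiplication by y - c preserves
        standard series; 1 is standard because 0 is not in G.\<close>
      moreover have "standard G s'"
        unfolding standard_def
      proof (intro allI ballI impI)
        fix \<alpha> m assume m: "m \<in> G" "m \<le> \<alpha>"
        have "\<alpha> \<noteq> 0"
        proof
          assume "\<alpha> = 0"
          then have "m = 0" using m(2) by (auto simp: le_fun_def fun_eq_iff)
          then show False using False m(1) by simp
        qed
        moreover have "m \<le> \<alpha> - unit_exp D"
          using m(2) Gm(2)[OF m(1)] by (auto simp: le_fun_def unit_exp_def)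
        ultimately show "coeff s' \<alpha> = 0"
          using standardD[OF s(2) m] standardD[OF s(2) m(1), of "\<alpha> - unit_exp D"]
          by (simp add: s'_def coeff_1 left_diff_distrib coeff_var_mult)
      qed
      ultimately have "s' = 0"
        using G(3) g(1) r HJ Q sat
        by (intro standard_combination_eq_0[OF J, where G = G and g = g and H = H
              and Q = "\<lambda>m. (?y - const c) * Q m" and r = r]) auto
      then have one: "(?y - const c) * s = 1" by (simp add: s'_def)
      have "s = 0" by (rule linear_multiple_free[OF r(1) s(1) c]) (simp add: one)
      then show False using one by simp
    qed
    then show ?thesis using r by blast
  qed
qed

end

section \<open>Varying the specialization\<close>

context complete_nonarch_field
begin

lemma T_Suc: "f \<in> T d 1 \<Longrightarrow> f \<in> T (Suc d) 1"
  and free_of_T: "f \<in> T d 1 \<Longrightarrow> free_of (Suc d) f"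
  and T_of_free: "f \<in> T (Suc d) 1 \<Longrightarrow> free_of (Suc d) f \<Longrightarrow> f \<in> T d 1"
  using T_Suc_iff[of f d 1] by auto

text \<open>To move an arbitrary center \<open>a\<close> to \<open>0\<close> without substituting into power series, add a
  variable \<open>y\<close> together with the relation \<open>y = z - a\<close>.\<close>

lemma trivial_at_near:
  assumes I: "is_ideal d I" and a: "v a \<le> 1"
  shows "\<exists>\<epsilon>>0. (\<forall>c. c \<noteq> a \<longrightarrow> v (c - a) \<le> \<epsilon> \<longrightarrow> trivial_at d I c) \<or>
    (\<forall>c. v (c - a) \<le> \<epsilon> \<longrightarrow> \<not> trivial_at d I c)"
proof -
  define y :: "'k mps" where "y = var (Suc d)"
  define b :: "'k mps" where "b = var d - const a"
  have bT: "b \<in> T d 1" by (simp add: b_def)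
  note b = T_Suc[OF bT] free_of_T[OF bT]
  have nb_b: "nb (Suc d) 1 1 b"
  proof -
    have "nb d 1 1 b" unfolding b_def using a by (intro nb_diff nb_var nb_const) auto
    then show ?thesis by (simp add: nb_def)
  qed
  have y: "y \<in> T (Suc d) 1" by (simp add: y_def)
  \<comment> \<open>This is the ideal generated by I and y - b. Elements of I need no coefficients
    from the larger ring: division by y - b replaces such a coefficient by one free of y.\<close>
  define I' where "I' = {F. \<exists>V\<in>T (Suc d) 1. \<exists>f\<in>I. F = (y - b) * V + f}"
  have I': "is_ideal (Suc d) I'"
    unfolding is_ideal_def
  proof (intro conjI ballI)
    show "I' \<subseteq> T (Suc d) 1"
      using is_idealD(1)[OF I] T_Suc b y by (auto simp: I'_def)
    show "0 \<in> I'" unfolding I'_def using is_idealD(2)[OF I]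
      by (intro CollectI bexI[of _ 0]) auto
    fix F G assume F: "F \<in> I'"
    then obtain V f where V: "V \<in> T (Suc d) 1" "f \<in> I" "F = (y - b) * V + f" by (auto simp: I'_def)
    show "F + G \<in> I'" if G: "G \<in> I'"
    proof -
      obtain W g where W: "W \<in> T (Suc d) 1" "g \<in> I" "G = (y - b) * W + g" using G by (auto simp: I'_def)
      have "F + G = (y - b) * (V + W) + (f + g)" unfolding V(3) W(3) by (simp add: algebra_simps)
      moreover have "V + W \<in> T (Suc d) 1" "f + g \<in> I" using V W is_idealD(3)[OF I] by auto
      ultimately show ?thesis unfolding I'_def by blast
    qed
    show "G * F \<in> I'" if G: "G \<in> T (Suc d) 1"
    proof -
      obtain Q q where Q: "Q \<in> T (Suc d) 1" "q \<in> T (Suc d) 1" "free_of (Suc d) q" "G = (y - b) * Q + q"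
        using linear_division[OF _ b nb_b G] by (auto simp: y_def)
      have "G * F = G * ((y - b) * V) + G * f" by (simp only: V(3) distrib_left)
      also have "G * f = ((y - b) * Q + q) * f" by (simp only: Q(4))
      finally have "G * F = (y - b) * (G * V + Q * f) + q * f" by (simp add: algebra_simps)
      moreover have "q * f \<in> I" using is_idealD(4)[OF I] T_of_free Q V by blast
      moreover have "G * V + Q * f \<in> T (Suc d) 1"
        using G V Q T_Suc is_idealD(1)[OF I] by (intro T_add T_mult) auto
      ultimately show ?thesis unfolding I'_def by blast
    qed
  qed
  have iff: "trivial_at (Suc d) I' c \<longleftrightarrow> trivial_at d I (a + c)" if c: "v c \<le> 1" for c
  proof
    have zc: "var d - const (a + c) = b - const c" by (simp add: b_def const_add)
    show "trivial_at d I (a + c)" if triv: "trivial_at (Suc d) I' c"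
    proof -
      obtain V h U where V: "V \<in> T (Suc d) 1" and h: "h \<in> I" and U: "U \<in> T (Suc d) 1"
        and eq: "1 = ((y - b) * V + h) + (y - const c) * U"
        using triv by (auto simp: trivial_at_def I'_def y_def)
      obtain V' w where V': "V' \<in> T (Suc d) 1" "w \<in> T (Suc d) 1" "free_of (Suc d) w"
        "V = (y - const c) * V' + w"
        using evaluation_remainder[of 1 c V "Suc d"] c V by (auto simp: y_def)
      have w: "w \<in> T d 1" using T_of_free V' by blast
      have hT: "h \<in> T d 1" using is_idealD(1)[OF I h] .
      \<comment> \<open>Here w is the value of V at y = c. All multiples of y - c are collected in
        X; the other side is free of y, so both sides vanish, which is the relation evaluated at y =
        c.\<close>
      let ?X = "(y - b) * V' + w + U" and ?r = "1 - h + (b - const c) * w"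
      have X: "(y - const c) * ?X = ?r"
        by (subst eq) (simp add: V'(4) algebra_simps)
      have "?r \<in> T d 1" using hT bT w by (intro T_add T_diff T_mult) auto
      then have "free_of (Suc d) ((var (Suc d) - const c) * ?X)" using X free_of_T by (simp add: y_def)
      then have "?X = 0"
        using c y b V' U by (intro linear_multiple_free[of 1 _ "Suc d" c] T_add T_mult T_diff) auto
      then have "?r = 0" using X by simp
      then have "1 = h + (b - const c) * (- w)" by (simp add: algebra_simps)
      then show ?thesis unfolding trivial_at_def zc using h T_minus[OF zero_less_one w] by blast
    qed
    show "trivial_at (Suc d) I' c" if triv: "trivial_at d I (a + c)"
    proof -
      obtain H U where H: "H \<in> I" and U: "U \<in> T d 1" and eq: "1 = H + (b - const c) * U"
        using triv by (auto simp: trivial_at_def zc)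
      have "1 = ((y - b) * (- U) + H) + (y - const c) * U"
        by (subst eq) (simp add: algebra_simps)
      moreover have "(y - b) * (- U) + H \<in> I'"
        unfolding I'_def using H T_minus[OF zero_less_one T_Suc[OF U]] by blast
      ultimately show ?thesis unfolding trivial_at_def y_def using T_Suc[OF U] by blast
    qed
  qed
  obtain \<epsilon> where \<epsilon>: "\<epsilon> > 0" "\<epsilon> \<le> 1"
    "(\<forall>c. c \<noteq> 0 \<longrightarrow> v c \<le> \<epsilon> \<longrightarrow> trivial_at (Suc d) I' c) \<or> (\<forall>c. v c \<le> \<epsilon> \<longrightarrow> \<not> trivial_at (Suc d) I' c)"
    using trivial_at_near_0[OF I'] by blast
  have iff': "trivial_at (Suc d) I' (c - a) \<longleftrightarrow> trivial_at d I c" if "v (c - a) \<le> \<epsilon>" for c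
    using iff[of "c - a"] that \<epsilon>(2) by simp
  from \<epsilon>(3) show ?thesis
  proof
    assume *: "\<forall>c. c \<noteq> 0 \<longrightarrow> v c \<le> \<epsilon> \<longrightarrow> trivial_at (Suc d) I' c"
    have "trivial_at d I c" if "c \<noteq> a" "v (c - a) \<le> \<epsilon>" for c
      using * iff'[of c] that by simp
    then show ?thesis using \<epsilon>(1) by blast
  next
    assume *: "\<forall>c. v c \<le> \<epsilon> \<longrightarrow> \<not> trivial_at (Suc d) I' c"
    have "\<not> trivial_at d I c" if "v (c - a) \<le> \<epsilon>" for c
      using * iff'[of c] that by simp
    then show ?thesis using \<epsilon>(1) by blast
  qed
qed

lemma trivial_at_open:
  assumes I: "is_ideal d I" and triv: "trivial_at d I c"
  shows "\<exists>\<delta>>0. \<forall>c'. v (c' - c) < \<delta> \<longrightarrow> trivial_at d I c'"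
proof -
  obtain H U where H: "H \<in> I" and U: "U \<in> T d 1" and eq: "1 = H + (var d - const c) * U"
    using triv by (auto simp: trivial_at_def)
  obtain B where B: "B > 0" "nb d 1 B U" using T_bounded[OF _ U] by auto
  have "trivial_at d I c'" if c': "v (c' - c) < 1 / (2 * B)" for c'
  proof -
    \<comment> \<open>Replacing c by c' in the relation gives u in place of 1. The bound 1 / (2 * B)
      makes u - 1 of norm at most 1/2, and dividing by u restores the 1.\<close>
    define u where "u = 1 - const (c' - c) * U"
    have u: "u = H + (var d - const c') * U"
      unfolding u_def by (subst eq) (simp add: const_diff algebra_simps)
    have small: "v ((c' - c) * coeff U \<alpha>) \<le> 1/2" for \<alpha>
    proof -
      have "v (c' - c) * v (coeff U \<alpha>) \<le> 1 / (2 * B) * B"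
        using c' nbD[OF B(2), of \<alpha>] B(1) by (intro mult_mono) auto
      then show ?thesis using B(1) by (simp add: v_mult)
    qed
    define u0 where "u0 = coeff u 0"
    have "v 1 \<le> max (v u0) (v ((c' - c) * coeff U 0))"
      using v_add_le[of u0 "(c' - c) * coeff U 0"] by (simp add: u0_def u_def coeff_1)
    \<comment> \<open>\<open>unit_near_1\<close> wants constant coefficient exactly 1. As |u0| \<ge>
      1, dividing by u0 does not enlarge the other terms.\<close>
    then have u0: "1 \<le> v u0" using small[of 0] by (simp add: max_def split: if_splits)
    then have "u0 \<noteq> 0" by auto
    define k where "k = inverse u0"
    have k: "k * u0 = 1" using \<open>u0 \<noteq> 0\<close> by (simp add: k_def)
    have "v k * v u0 = 1" using k v_mult[of k u0] by simp
    then have vk: "v k \<le> 1" using u0 mult_left_mono[OF u0, of "v k"] by simp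
    have uT: "const k * u \<in> T d 1" using U by (simp add: u_def)
    have "\<exists>Q\<in>T d 1. Q * (const k * u) = 1"
    proof (rule unit_near_1[where \<theta> = "1/2"])
      show "coeff (const k * u) 0 = 1" using k by (simp add: u0_def)
      show "v (coeff (const k * u) \<alpha>) * 1 ^ \<alpha> d \<le> 1/2" if "\<alpha> \<noteq> 0" for \<alpha>
      proof -
        have "v (coeff (const k * u) \<alpha>) = v k * v ((c' - c) * coeff U \<alpha>)"
          using that by (simp add: u_def coeff_1 v_mult)
        also have "\<dots> \<le> 1 * (1/2)" using vk small by (intro mult_mono) auto
        finally show ?thesis by simp
      qed
    qed (use uT in auto)
    then obtain Q where Q: "Q \<in> T d 1" "Q * (const k * u) = 1" by blast
    let ?q = "Q * const k"
    have q: "?q \<in> T d 1" using Q(1) by simp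
    have "1 = ?q * H + (var d - const c') * (?q * U)"
      using Q(2) by (simp add: u algebra_simps)
    moreover have "?q * H \<in> I" using is_idealD(4)[OF I q H] .
    moreover have "?q * U \<in> T d 1" using q U by simp
    ultimately show ?thesis unfolding trivial_at_def by blast
  qed
  moreover have "1 / (2 * B) > 0" using B(1) by simp
  ultimately show ?thesis by blast
qed

end

section \<open>Modules over the Tate algebra\<close>

lemma coeff_mult_tate: "coeff (f * g) = tate_mult (coeff f) (coeff g)"
proof
  fix \<alpha>
  show "coeff (f * g) \<alpha> = tate_mult (coeff f) (coeff g) \<alpha>"
  proof (cases "finite_exp \<alpha>")
    case True
    then show ?thesis by (simp add: coeff_mult tate_mult_conv_splits)
  next
    case False
    then have "coeff f \<beta> * coeff g \<gamma> = 0" if "(\<beta>, \<gamma>) \<in> splits \<alpha>" for \<beta> \<gamma>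
      using that coeff_infinite[of \<beta> f] coeff_infinite[of \<gamma> g] by (auto simp: splits_def)
    then have "tate_mult (coeff f) (coeff g) \<alpha> = 0"
      unfolding tate_mult_conv_splits by (intro sum.neutral) auto
    then show ?thesis using False by (simp add: coeff_infinite)
  qed
qed

lemma coeff_linear_tate: "coeff (var d - const c) = tate_z_minus d c"
proof -
  have "(\<lambda>i. 0) = (0 :: nat \<Rightarrow> nat)" by auto
  then show ?thesis
    by (intro ext) (simp only: tate_z_minus_def coeff_diff coeff_var coeff_const unit_exp_def)
qed

locale tate_module = complete_nonarch_field v for v :: "'k::field \<Rightarrow> real" +
  fixes d :: nat and M :: "('k tate, 'm) module"
  assumes module: "Module.module (tate_ring v d) M"
begin

sublocale M: Module.module "tate_ring v d" M
  by (rule module)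

lemma coeff_T: "f \<in> T d 1 \<longleftrightarrow> coeff f \<in> carrier (tate_ring v d)"
  by (simp add: tate_ring_def tate_carrier_def T_def)

lemma carrier_coeff: "F \<in> carrier (tate_ring v d) \<Longrightarrow> \<exists>f\<in>T d 1. coeff f = F"
proof -
  assume F: "F \<in> carrier (tate_ring v d)"
  then have "F \<alpha> = 0" if "\<not> finite_exp \<alpha>" for \<alpha>
    using that monomials_finite_exp by (auto simp: tate_ring_def tate_carrier_def)
  then have "coeff (Abs_mps F) = F" by (simp add: Abs_mps_inverse)
  then show ?thesis using F coeff_T by metis
qed

definition act :: "'k mps \<Rightarrow> 'm \<Rightarrow> 'm" where
  "act f m = coeff f \<odot>\<^bsub>M\<^esub> m"

lemma act_closed [simp]: "f \<in> T d 1 \<Longrightarrow> m \<in> carrier M \<Longrightarrow> act f m \<in> carrier M"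
  by (simp add: act_def coeff_T)

lemma act_add:
  assumes "f \<in> T d 1" "g \<in> T d 1" "m \<in> carrier M"
  shows "act (f + g) m = act f m \<oplus>\<^bsub>M\<^esub> act g m"
proof -
  have "coeff (f + g) = coeff f \<oplus>\<^bsub>tate_ring v d\<^esub> coeff g" by (simp add: tate_ring_def fun_eq_iff)
  then show ?thesis using assms by (simp add: act_def coeff_T M.smult_l_distr)
qed

lemma act_mult:
  assumes "f \<in> T d 1" "g \<in> T d 1" "m \<in> carrier M"
  shows "act (f * g) m = act f (act g m)"
proof -
  have "coeff (f * g) = coeff f \<otimes>\<^bsub>tate_ring v d\<^esub> coeff g" by (simp add: tate_ring_def coeff_mult_tate)
  then show ?thesis using assms by (simp add: act_def coeff_T M.smult_assoc1)
qed

lemma act_1 [simp]: "m \<in> carrier M \<Longrightarrow> act 1 m = m"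
proof -
  assume "m \<in> carrier M"
  moreover have "coeff 1 = \<one>\<^bsub>tate_ring v d\<^esub>" by (simp add: tate_ring_def fun_eq_iff coeff_1)
  ultimately show ?thesis by (simp add: act_def)
qed

lemma act_0 [simp]: "m \<in> carrier M \<Longrightarrow> act 0 m = \<zero>\<^bsub>M\<^esub>"
proof -
  assume "m \<in> carrier M"
  moreover have "coeff 0 = \<zero>\<^bsub>tate_ring v d\<^esub>" by (simp add: tate_ring_def fun_eq_iff)
  ultimately show ?thesis by (simp add: act_def)
qed

lemma act_distrib:
  assumes "f \<in> T d 1" "m \<in> carrier M" "m' \<in> carrier M"
  shows "act f (m \<oplus>\<^bsub>M\<^esub> m') = act f m \<oplus>\<^bsub>M\<^esub> act f m'"
  using assms by (simp add: act_def coeff_T M.smult_r_distr)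

lemma act_zero [simp]: "f \<in> T d 1 \<Longrightarrow> act f \<zero>\<^bsub>M\<^esub> = \<zero>\<^bsub>M\<^esub>"
  by (simp add: act_def coeff_T)

lemma act_commute:
  assumes "f \<in> T d 1" "g \<in> T d 1" "m \<in> carrier M"
  shows "act f (act g m) = act g (act f m)"
  using assms by (metis act_mult mult.commute)

section \<open>The annihilator and Nakayama's lemma\<close>

definition annihilator :: "'k mps set" where
  "annihilator = {f \<in> T d 1. \<forall>m\<in>carrier M. act f m = \<zero>\<^bsub>M\<^esub>}"

lemma is_ideal_annihilator: "is_ideal d annihilator"
  by (auto simp: is_ideal_def annihilator_def act_add act_mult)

text \<open>Recursion on the number of generators lets the proof of Nakayama's lemma discard the
  last one.\<close>

fun span :: "(nat \<Rightarrow> 'm) \<Rightarrow> nat \<Rightarrow> 'm set" where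
  "span g 0 = {\<zero>\<^bsub>M\<^esub>}"
| "span g (Suc k) = {x \<oplus>\<^bsub>M\<^esub> act a (g k) | x a. x \<in> span g k \<and> a \<in> T d 1}"

context
  fixes g :: "nat \<Rightarrow> 'm" and n :: nat
  assumes g: "\<And>i. i < n \<Longrightarrow> g i \<in> carrier M"
begin

lemma span_closed: "k \<le> n \<Longrightarrow> x \<in> span g k \<Longrightarrow> x \<in> carrier M"
  by (induction k arbitrary: x) (auto simp: g)

lemma span_act:
  "k \<le> n \<Longrightarrow> f \<in> T d 1 \<Longrightarrow> x \<in> span g k \<Longrightarrow> act f x \<in> span g k"
proof (induction k arbitrary: x)
  case (Suc k)
  then obtain y a where y: "x = y \<oplus>\<^bsub>M\<^esub> act a (g k)" "y \<in> span g k" "a \<in> T d 1" by auto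
  then have "act f x = act f y \<oplus>\<^bsub>M\<^esub> act (f * a) (g k)"
    using Suc.prems span_closed[of k y] g[of k] by (simp add: act_distrib act_mult)
  moreover have "act f y \<in> span g k" using Suc y by simp
  moreover have "f * a \<in> T d 1" using Suc.prems y by simp
  ultimately show ?case unfolding span.simps by blast
qed simp

lemma span_add:
  "k \<le> n \<Longrightarrow> x \<in> span g k \<Longrightarrow> y \<in> span g k \<Longrightarrow> x \<oplus>\<^bsub>M\<^esub> y \<in> span g k"
proof (induction k arbitrary: x y)
  case (Suc k)
  obtain x' a where x: "x = x' \<oplus>\<^bsub>M\<^esub> act a (g k)" "x' \<in> span g k" "a \<in> T d 1"
    using Suc.prems(2) by auto
  obtain y' b where y: "y = y' \<oplus>\<^bsub>M\<^esub> act b (g k)" "y' \<in> span g k" "b \<in> T d 1"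
    using Suc.prems(3) by auto
  have k: "k \<le> n" "g k \<in> carrier M" using Suc.prems(1) g by auto
  have "x \<oplus>\<^bsub>M\<^esub> y = (x' \<oplus>\<^bsub>M\<^esub> y') \<oplus>\<^bsub>M\<^esub> act (a + b) (g k)"
    using x y k span_closed[OF k(1)] by (simp add: act_add M.add.m_ac)
  moreover have "x' \<oplus>\<^bsub>M\<^esub> y' \<in> span g k" using Suc.IH k x y by simp
  moreover have "a + b \<in> T d 1" using x y by simp
  ultimately show ?case unfolding span.simps by blast
qed simp

lemma finsum_in_span:
  assumes "\<And>i. i < n \<Longrightarrow> a i \<in> carrier (tate_ring v d)"
  shows "k \<le> n \<Longrightarrow> finsum M (\<lambda>i. a i \<odot>\<^bsub>M\<^esub> g i) {..<k} \<in> span g k"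
proof (induction k)
  case (Suc k)
  obtain f where f: "f \<in> T d 1" "coeff f = a k" using carrier_coeff assms[of k] Suc.prems by auto
  have "finsum M (\<lambda>i. a i \<odot>\<^bsub>M\<^esub> g i) {..<Suc k}
      = a k \<odot>\<^bsub>M\<^esub> g k \<oplus>\<^bsub>M\<^esub> finsum M (\<lambda>i. a i \<odot>\<^bsub>M\<^esub> g i) {..<k}"
    unfolding lessThan_Suc using Suc.prems assms g by (intro M.finsum_insert) auto
  also have "\<dots> = finsum M (\<lambda>i. a i \<odot>\<^bsub>M\<^esub> g i) {..<k} \<oplus>\<^bsub>M\<^esub> act f (g k)"
    using Suc.prems assms g by (subst M.add.m_comm) (auto simp: act_def f intro!: M.finsum_closed)
  finally show ?case using Suc f(1) by auto
qed simp

text \<open>Elimination in place of determinants: after j rounds some element congruent to 1 modulo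
  w maps M into the span of the first n - j generators; after n rounds it annihilates M.\<close>

lemma nakayama:
  assumes w: "w \<in> T d 1" and gen: "\<And>m. m \<in> carrier M \<Longrightarrow> m \<in> span g n"
    and surj: "\<And>m. m \<in> carrier M \<Longrightarrow> \<exists>m'\<in>carrier M. m = act w m'"
  shows "\<exists>U\<in>T d 1. 1 - w * U \<in> annihilator"
proof -
  have "\<exists>U\<in>T d 1. \<forall>m\<in>carrier M. act (1 - w * U) m \<in> span g (n - j)" if "j \<le> n" for j
    using that
  proof (induction j)
    case 0
    show ?case using gen by (intro bexI[of _ 0]) auto
  next
    case (Suc j)
    define k where "k = n - Suc j"
    have k: "n - j = Suc k" "k \<le> n" "Suc k \<le> n" "g k \<in> carrier M" using Suc.prems g by (auto simp: k_def)
    obtain U where U: "U \<in> T d 1" "\<And>m. m \<in> carrier M \<Longrightarrow> act (1 - w * U) m \<in> span g (Suc k)"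
      using Suc k(1) by auto
    define f where "f = 1 - w * U"
    have f: "f \<in> T d 1" using w U by (simp add: f_def)
    obtain m' where m': "m' \<in> carrier M" "g k = act w m'" using surj k(4) by blast
    obtain x a where x: "act f m' = x \<oplus>\<^bsub>M\<^esub> act a (g k)" "x \<in> span g k" "a \<in> T d 1"
      using U(2)[OF m'(1)] by (auto simp: f_def)
    have xM: "x \<in> carrier M" using span_closed[OF k(2)] x by blast
    \<comment> \<open>Since f maps m' to x + a g_k and g_k = w m', it maps g_k to w x + w a g_k.
      Hence h maps g_k into the span of the earlier generators, and h f is still congruent to 1
      modulo w.\<close>
    define h where "h = f - w * a"
    have h: "h \<in> T d 1" using f w x by (simp add: h_def)
    have "act h (g k) \<oplus>\<^bsub>M\<^esub> act (w * a) (g k) = act (h + w * a) (g k)"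
      using h w x k by (simp add: act_add)
    also have "\<dots> = act f (act w m')" by (simp add: h_def m'(2)[symmetric])
    also have "\<dots> = act w (act f m')" using act_commute f w m' by blast
    also have "\<dots> = act w x \<oplus>\<^bsub>M\<^esub> act (w * a) (g k)"
      using x xM w k by (simp add: act_distrib act_mult)
    finally have hg: "act h (g k) = act w x"
      using h w x xM k by (subst (asm) M.add.right_cancel) auto
    have "act (h * f) m \<in> span g k" if m: "m \<in> carrier M" for m
    proof -
      obtain x' b where x': "act f m = x' \<oplus>\<^bsub>M\<^esub> act b (g k)" "x' \<in> span g k" "b \<in> T d 1"
        using U(2)[OF m] by (auto simp: f_def)
      have x'M: "x' \<in> carrier M" using span_closed[OF k(2)] x' by blast
      have "act (h * f) m = act h x' \<oplus>\<^bsub>M\<^esub> act h (act b (g k))"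
        using h f m x' x'M k by (simp add: act_mult act_distrib)
      also have "act h (act b (g k)) = act b (act w x)" using act_commute h x' k hg by metis
      finally show ?thesis using span_act span_add k h w x x' by simp
    qed
    moreover have "h * f = 1 - w * (U + (U + a) * f)"
      by (simp add: h_def f_def algebra_simps)
    moreover have "U + (U + a) * f \<in> T d 1" using U f x by simp
    ultimately show ?case unfolding k_def by auto
  qed
  from this[of n] obtain U where U: "U \<in> T d 1" "\<forall>m\<in>carrier M. act (1 - w * U) m = \<zero>\<^bsub>M\<^esub>" by auto
  then have "1 - w * U \<in> annihilator" using w by (simp add: annihilator_def)
  with U show ?thesis by blast
qed

end

lemma specializes_to_zero_iff:
  assumes "fin_gen_module (tate_ring v d) M"
  shows "specializes_to_zero d M c \<longleftrightarrow> trivial_at d annihilator c"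
proof
  let ?w = "var d - const c :: 'k mps"
  have w: "?w \<in> T d 1" by simp
  have act_w: "act ?w m = tate_z_minus d c \<odot>\<^bsub>M\<^esub> m" for m by (simp add: act_def coeff_linear_tate)
  show "trivial_at d annihilator c" if sp: "specializes_to_zero d M c"
  proof -
    have "\<exists>(n::nat) g. (\<forall>i<n. g i \<in> carrier M) \<and>
        (\<forall>m\<in>carrier M. \<exists>a. (\<forall>i<n. a i \<in> carrier (tate_ring v d)) \<and>
            m = finsum M (\<lambda>i. a i \<odot>\<^bsub>M\<^esub> g i) {..<n})"
      using assms unfolding fin_gen_module_def by (rule conjunct2)
    then obtain n g where ng: "(\<forall>i<n::nat. g i \<in> carrier M) \<and>
        (\<forall>m\<in>carrier M. \<exists>a. (\<forall>i<n. a i \<in> carrier (tate_ring v d)) \<and>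
            m = finsum M (\<lambda>i. a i \<odot>\<^bsub>M\<^esub> g i) {..<n})"
      by (elim exE)
    then have g: "\<And>i. i < n \<Longrightarrow> g i \<in> carrier M" by blast
    have spanning: "m \<in> span g n" if m: "m \<in> carrier M" for m
    proof -
      obtain a where a: "\<forall>i<n. a i \<in> carrier (tate_ring v d)"
        "m = finsum M (\<lambda>i. a i \<odot>\<^bsub>M\<^esub> g i) {..<n}"
        using ng m by meson
      then show ?thesis using finsum_in_span[of n g a n] g by simp
    qed
    have "\<exists>m'\<in>carrier M. m = act ?w m'" if "m \<in> carrier M" for m
      using sp that unfolding specializes_to_zero_def act_w by blast
    from nakayama[OF g w spanning this] obtain U where "U \<in> T d 1" "1 - ?w * U \<in> annihilator"
      by blast
    moreover have "1 = (1 - ?w * U) + ?w * U" by simp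
    ultimately show ?thesis unfolding trivial_at_def by blast
  qed
  show "specializes_to_zero d M c" if triv: "trivial_at d annihilator c"
  proof -
    obtain H U where H: "H \<in> annihilator" and U: "U \<in> T d 1" and eq: "1 = H + ?w * U"
      using triv by (auto simp: trivial_at_def)
    have "m = act ?w (act U m)" if m: "m \<in> carrier M" for m
    proof -
      have "m = act (H + ?w * U) m" using m eq by simp
      also have "\<dots> = act H m \<oplus>\<^bsub>M\<^esub> act (?w * U) m"
        using H U m w by (intro act_add) (auto simp: annihilator_def)
      also have "\<dots> = act ?w (act U m)" using H U m w by (simp add: annihilator_def act_mult)
      finally show ?thesis .
    qed
    then show ?thesis using U unfolding specializes_to_zero_def act_w[symmetric] by (meson act_closed)
  qed
qed

end

section \<open>From local to global\<close>

context nonarch_field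
begin

lemma v_diff_triangle: "v (x - z) \<le> max (v (x - y)) (v (y - z))"
  using v_add_le[of "x - y" "y - z"] by simp

lemma v_of_nat_le: "v (of_nat n) \<le> 1"
proof (induction n)
  case (Suc n)
  then show ?case using v_add_le[of 1 "of_nat n"] by simp
qed simp

lemma v_of_int_le: "v (of_int n) \<le> 1"
  using v_of_nat_le by (cases n) (auto simp del: of_nat_Suc)

text \<open>Take a finite subcover by balls on which the dichotomy holds. Two points at distance at
  most the smallest radius lie in the same of these balls or both outside, so the ultrametric
  inequality gives a uniform radius; only the finitely many centres can be exceptional.\<close>

lemma rel_compact_uniform:
  assumes compact: "rel_compact v R"
    and local: "\<And>a. a \<in> R \<Longrightarrow> \<exists>\<epsilon>>0. (\<forall>c. c \<noteq> a \<longrightarrow> v (c - a) \<le> \<epsilon> \<longrightarrow> P c) \<or>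
      (\<forall>c. v (c - a) \<le> \<epsilon> \<longrightarrow> \<not> P c)"
  shows "\<exists>\<epsilon>>0. \<exists>C\<subseteq>R. finite ({c\<in>R. P c} - (\<Union>a\<in>C. rel_ball v R a \<epsilon>)) \<and>
    finite ((\<Union>a\<in>C. rel_ball v R a \<epsilon>) - {c\<in>R. P c})"
proof -
  have "\<forall>a\<in>R. \<exists>\<epsilon>. \<epsilon> > 0 \<and> ((\<forall>c. c \<noteq> a \<longrightarrow> v (c - a) \<le> \<epsilon> \<longrightarrow> P c) \<or> (\<forall>c. v (c - a) \<le> \<epsilon> \<longrightarrow> \<not> P c))"
    using local by blast
  then obtain e where e: "\<forall>a\<in>R. e a > 0 \<and>
      ((\<forall>c. c \<noteq> a \<longrightarrow> v (c - a) \<le> e a \<longrightarrow> P c) \<or> (\<forall>c. v (c - a) \<le> e a \<longrightarrow> \<not> P c))"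
    by (rule exE[OF bchoice])
  have "rel_open v R (rel_ball v R a (e a))" if a: "a \<in> R" for a
    unfolding rel_open_def
  proof (intro conjI ballI)
    show "rel_ball v R a (e a) \<subseteq> R" by (auto simp: rel_ball_def)
    fix c assume c: "c \<in> rel_ball v R a (e a)"
    have "c' \<in> rel_ball v R a (e a)" if "c' \<in> R" "v (c' - c) < e a" for c'
      using v_diff_triangle[of c' a c] that c by (auto simp: rel_ball_def)
    then show "\<exists>\<delta>>0. \<forall>c'\<in>R. v (c' - c) < \<delta> \<longrightarrow> c' \<in> rel_ball v R a (e a)"
      using e a by blast
  qed
  then have "\<forall>U\<in>(\<lambda>a. rel_ball v R a (e a)) ` R. rel_open v R U" by blast
  moreover have "R \<subseteq> \<Union> ((\<lambda>a. rel_ball v R a (e a)) ` R)"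
  proof
    fix a assume a: "a \<in> R"
    then have "0 < e a" using e by blast
    then have "a \<in> rel_ball v R a (e a)" using a by (simp add: rel_ball_def)
    then show "a \<in> \<Union> ((\<lambda>a. rel_ball v R a (e a)) ` R)" using a by blast
  qed
  ultimately obtain \<F> where \<F>: "\<F> \<subseteq> (\<lambda>a. rel_ball v R a (e a)) ` R" "finite \<F>" "R \<subseteq> \<Union>\<F>"
    using compact unfolding rel_compact_def by meson
  then obtain A where A: "A \<subseteq> R" "finite A" "\<F> = (\<lambda>a. rel_ball v R a (e a)) ` A"
    by (meson finite_subset_image)
  have cover: "\<exists>a\<in>A. v (c - a) \<le> e a" if "c \<in> R" for c
    using \<F>(3) A(3) that by (auto simp: rel_ball_def)
  define \<epsilon> where "\<epsilon> = Min (insert 1 (e ` A))"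
  have "\<epsilon> \<in> insert 1 (e ` A)" unfolding \<epsilon>_def using A(2) by (intro Min_in) auto
  then have "\<epsilon> > 0" using e A(1) by auto
  have \<epsilon>_le: "\<epsilon> \<le> e a" if "a \<in> A" for a unfolding \<epsilon>_def using A(2) that by (intro Min_le) auto
  define A1 where "A1 = {a\<in>A. \<forall>c. c \<noteq> a \<longrightarrow> v (c - a) \<le> e a \<longrightarrow> P c}"
  have A2: "\<not> P c" if "a \<in> A" "a \<notin> A1" "v (c - a) \<le> e a" for a c
    using that A(1) e by (auto simp: A1_def)
  define C where "C = {c\<in>R. \<exists>a\<in>A1. v (c - a) \<le> e a}"
  have sub1: "{c\<in>R. P c} \<subseteq> (\<Union>a\<in>C. rel_ball v R a \<epsilon>)"
  proof
    fix c assume "c \<in> {c\<in>R. P c}"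
    then have c: "c \<in> R" "P c" by auto
    then obtain a where "a \<in> A" "v (c - a) \<le> e a" using cover by blast
    then have "c \<in> C" using A2 c by (auto simp: C_def)
    moreover have "c \<in> rel_ball v R c \<epsilon>" using c \<open>\<epsilon> > 0\<close> by (simp add: rel_ball_def)
    ultimately show "c \<in> (\<Union>a\<in>C. rel_ball v R a \<epsilon>)" by blast
  qed
  have sub2: "(\<Union>a\<in>C. rel_ball v R a \<epsilon>) - {c\<in>R. P c} \<subseteq> A"
  proof
    fix c assume "c \<in> (\<Union>a\<in>C. rel_ball v R a \<epsilon>) - {c\<in>R. P c}"
    then obtain b where b: "b \<in> C" "v (c - b) \<le> \<epsilon>" and c: "c \<in> R" "\<not> P c"
      by (auto simp: rel_ball_def)
    then obtain a where a: "a \<in> A1" "v (b - a) \<le> e a" by (auto simp: C_def)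
    then have "a \<in> A" by (simp add: A1_def)
    have "v (c - a) \<le> e a"
      using v_diff_triangle[of c a b] b(2) a(2) \<epsilon>_le[OF \<open>a \<in> A\<close>] by simp
    then have "c = a" using a(1) c(2) by (auto simp: A1_def)
    then show "c \<in> A" using \<open>a \<in> A\<close> by simp
  qed
  have "{c\<in>R. P c} - (\<Union>a\<in>C. rel_ball v R a \<epsilon>) = {}" using sub1 by blast
  then have "finite ({c\<in>R. P c} - (\<Union>a\<in>C. rel_ball v R a \<epsilon>))" by (simp only: finite.emptyI)
  moreover have "finite ((\<Union>a\<in>C. rel_ball v R a \<epsilon>) - {c\<in>R. P c})"
    using sub2 A(2) by (rule finite_subset)
  moreover have "C \<subseteq> R" by (auto simp: C_def)
  ultimately show ?thesis using \<open>\<epsilon> > 0\<close>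
    by - (rule exI[of _ \<epsilon>], intro conjI exI[of _ C])
qed

end

text \<open>\<open>\<int>\<close> is dense in the compact ring of \<open>p\<close>-adic integers: instead of a finite cover, use that
  a nested sequence of residue classes shrinks to a point of \<open>K\<close>.\<close>

lemma (in complete_nonarch_field) integer_uniform:
  fixes p :: nat
  assumes inj: "inj (of_int :: int \<Rightarrow> 'k)" and p: "p > 1" "v (of_nat p) = 1 / real p"
    and local: "\<And>a. v a \<le> 1 \<Longrightarrow> \<exists>\<epsilon>>0. (\<forall>c. c \<noteq> a \<longrightarrow> v (c - a) \<le> \<epsilon> \<longrightarrow> P c) \<or>
      (\<forall>c. v (c - a) \<le> \<epsilon> \<longrightarrow> \<not> P c)"
  shows "\<exists>r::nat. \<exists>A::int set. finite A \<and>
    finite ({n::int. P (of_int n)} - {n. \<exists>a\<in>A. n mod (int p ^ r) = a mod (int p ^ r)}) \<and>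
    finite ({n. \<exists>a\<in>A. n mod (int p ^ r) = a mod (int p ^ r)} - {n::int. P (of_int n)})"
proof -
  define S where "S = {n::int. P (of_int n)}"
  define cl where "cl k n = {m::int. int p ^ k dvd m - n}" for k and n :: int
  \<comment> \<open>Up to a finite set, the residue class lies outside S or inside S. In the next
    definition, \<open>good\<close> classes become uniform after some refinement.\<close>
  define unif where "unif r n \<longleftrightarrow> finite (cl r n \<inter> S) \<or> finite (cl r n - S)" for r n
  define good where "good k n \<longleftrightarrow> (\<exists>r\<ge>k. \<forall>m\<in>cl k n. unif r m)" for k n
  have cl_mono: "cl r m \<subseteq> cl k m" if "k \<le> r" for k r m
    unfolding cl_def using le_imp_power_dvd[OF that, of "int p"] dvd_trans by blast
  have cl_trans: "x \<in> cl k n" if "x \<in> cl k m" "m \<in> cl k n" for x m n k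
    using dvd_add[of "int p ^ k" "x - m" "m - n"] that by (simp add: cl_def)
  have unif_mono: "unif r' n" if "unif r n" "r \<le> r'" for r r' n
    using that cl_mono[of r r' n] unfolding unif_def
    by (meson Diff_mono Int_mono finite_subset order_refl)
  \<comment> \<open>A class modulo p^k consists of p classes modulo p^(k+1). If each became uniform
    at some level, the largest of these levels would serve for all.\<close>
  have step: "\<exists>m\<in>cl k n. \<not> good (Suc k) m" if ng: "\<not> good k n" for k n
  proof (rule ccontr)
    assume "\<not> ?thesis"
    then have all: "\<forall>m\<in>cl k n. good (Suc k) m" by blast
    have "\<forall>i\<in>{..<p}. \<exists>r. Suc k \<le> r \<and> (\<forall>m\<in>cl (Suc k) (n + int i * int p ^ k). unif r m)"
    proof
      fix i
      have "n + int i * int p ^ k \<in> cl k n" by (simp add: cl_def)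
      then show "\<exists>r. Suc k \<le> r \<and> (\<forall>m\<in>cl (Suc k) (n + int i * int p ^ k). unif r m)"
        using all unfolding good_def by blast
    qed
    then obtain f where f: "\<forall>i\<in>{..<p}. Suc k \<le> f i \<and> (\<forall>m\<in>cl (Suc k) (n + int i * int p ^ k). unif (f i) m)"
      by (rule exE[OF bchoice])
    define r where "r = Max (insert k (f ` {..<p}))"
    have r: "k \<le> r" "\<And>i. i < p \<Longrightarrow> f i \<le> r" unfolding r_def by (auto intro!: Max_ge)
    have "unif r m" if m: "m \<in> cl k n" for m
    proof -
      obtain q where q: "m - n = int p ^ k * q" using m by (auto simp: cl_def)
      define i where "i = nat (q mod int p)"
      have i: "i < p" "int i = q mod int p" using p(1) by (auto simp: i_def nat_less_iff)
      have "m - (n + int i * int p ^ k) = int p ^ k * (q - q mod int p)"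
        using q i(2) by (simp add: algebra_simps)
      also have "\<dots> = int p ^ Suc k * (q div int p)"
        by (simp add: minus_mod_eq_mult_div)
      finally have "m \<in> cl (Suc k) (n + int i * int p ^ k)" by (simp add: cl_def)
      then have "unif (f i) m" using f i(1) by blast
      then show ?thesis using unif_mono r(2)[OF i(1)] by blast
    qed
    then show False using ng r(1) unfolding good_def by blast
  qed
  have v_cl: "v (of_int m - of_int n) \<le> (1 / real p) ^ k" if m: "m \<in> cl k n" for m n k
  proof -
    obtain q where q: "m - n = int p ^ k * q" using m by (auto simp: cl_def)
    have "(of_int m - of_int n :: 'k) = of_nat p ^ k * of_int q"
      using arg_cong[OF q, of "of_int :: int \<Rightarrow> 'k"] by simp
    also have "v \<dots> = (1 / real p) ^ k * v (of_int q)" by (simp add: v_mult v_power p(2))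
    also have "\<dots> \<le> (1 / real p) ^ k * 1" by (intro mult_left_mono v_of_int_le) auto
    finally show ?thesis by simp
  qed
  have small: "\<exists>k. (1 / real p) ^ k < e" if "e > 0" for e
    using p(1) that by (intro real_arch_pow_inv) auto
  have "good 0 0"
  proof (rule ccontr)
    assume bad: "\<not> good 0 0"
    \<comment> \<open>A descending chain of bad classes, chosen as in Koenig's lemma; its
      representatives form a Cauchy sequence.\<close>
    define s where "s = rec_nat 0 (\<lambda>k n. SOME m. m \<in> cl k n \<and> \<not> good (Suc k) m)"
    have s_0: "s 0 = 0" and s_Suc: "s (Suc k) = (SOME m. m \<in> cl k (s k) \<and> \<not> good (Suc k) m)" for k
      by (simp_all add: s_def)
    have s_step: "s (Suc k) \<in> cl k (s k) \<and> \<not> good (Suc k) (s (Suc k))" if "\<not> good k (s k)" for k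
      unfolding s_Suc using step[OF that]
      by (intro someI_ex[of "\<lambda>m. m \<in> cl k (s k) \<and> \<not> good (Suc k) m"]) (simp only: Bex_def)
    have s_bad: "\<not> good k (s k)" for k
      by (induction k) (use bad s_0 s_step in auto)
    have s_cl: "s m \<in> cl k (s k)" if "k \<le> m" for k m
      using that
    proof (induction m rule: dec_induct)
      case (step m)
      then have "s (Suc m) \<in> cl k (s m)" using s_step[OF s_bad] cl_mono by blast
      then show ?case using cl_trans step.IH by blast
    qed (simp add: cl_def)
    have near: "v (of_int (s m) - of_int (s k)) \<le> (1 / real p) ^ k" if "k \<le> m" for k m
      using v_cl s_cl that by blast
    have cauchy: "\<exists>N. \<forall>m\<ge>N. \<forall>n\<ge>N. v (of_int (s m) - of_int (s n) :: 'k) < e" if e: "e > 0" for e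
    proof -
      obtain N where N: "(1 / real p) ^ N < e" using small[OF e] by blast
      have "v (of_int (s m) - of_int (s n)) < e" if "m \<ge> N" "n \<ge> N" for m n
        using v_diff_triangle[of "of_int (s m)" "of_int (s n)" "of_int (s N)"]
          near[OF that(1)] near[OF that(2)] N v_diff_commute[of "of_int (s N)" "of_int (s n)"]
        by simp
      then show ?thesis by blast
    qed
    have "\<exists>L. \<forall>e>0. \<exists>N. \<forall>n\<ge>N. v (of_int (s n) - L) < e"
      by (rule complete_limit) (intro allI impI cauchy)
    then obtain L where L: "\<And>e. e > 0 \<Longrightarrow> \<exists>N. \<forall>n\<ge>N. v (of_int (s n) - L) < e"
      by (elim exE) blast
    have L_near: "v (of_int (s k) - L) \<le> (1 / real p) ^ k" for k
    proof -
      have "(1 / real p) ^ k > 0" using p(1) by simp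
      then obtain N where N: "\<forall>n\<ge>N. v (of_int (s n) - L) < (1 / real p) ^ k" using L by blast
      have "v (of_int (s (max N k)) - L) < (1 / real p) ^ k" using N by simp
      then show ?thesis
        using v_diff_triangle[of "of_int (s k)" L "of_int (s (max N k))"] near[of k "max N k"]
          v_diff_commute[of "of_int (s k)" "of_int (s (max N k))"] by simp
    qed
    have "v L \<le> 1"
      using L_near[of 0] v_diff_le[of "of_int (s 0)" "of_int (s 0) - L"] v_of_int_le[of "s 0"] by simp
    then obtain \<epsilon> where \<epsilon>: "\<epsilon> > 0"
      "(\<forall>c. c \<noteq> L \<longrightarrow> v (c - L) \<le> \<epsilon> \<longrightarrow> P c) \<or> (\<forall>c. v (c - L) \<le> \<epsilon> \<longrightarrow> \<not> P c)"
      using local by blast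
    obtain k where k: "(1 / real p) ^ k < \<epsilon>" using small[OF \<epsilon>(1)] by blast
    have close: "v (of_int m - L) \<le> \<epsilon>" if "m \<in> cl k (s k)" for m
      using v_diff_triangle[of "of_int m" L "of_int (s k)"] v_cl[OF that] L_near[of k] k by simp
    have "unif k m" if m: "m \<in> cl k (s k)" for m
      using \<epsilon>(2)
    proof
      assume *: "\<forall>c. c \<noteq> L \<longrightarrow> v (c - L) \<le> \<epsilon> \<longrightarrow> P c"
      \<comment> \<open>The limit L may itself be an integer and is then the only possible
        exception.\<close>
      have "cl k m - S \<subseteq> of_int -` {L}"
        using * close cl_trans[OF _ m] by (auto simp: S_def)
      moreover have "finite (of_int -` {L} :: int set)" using inj by (intro finite_vimageI) auto
      ultimately show ?thesis unfolding unif_def using finite_subset by blast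
    next
      assume *: "\<forall>c. v (c - L) \<le> \<epsilon> \<longrightarrow> \<not> P c"
      then have "cl k m \<inter> S = {}" using close cl_trans[OF _ m] by (auto simp: S_def)
      then show ?thesis by (simp add: unif_def)
    qed
    then show False using s_bad[of k] unfolding good_def by blast
  qed
  \<comment> \<open>At level 0 the modulus is 1, so the class of 0 is all of the integers.\<close>
  then obtain r where r: "\<And>m. unif r m" by (auto simp: good_def cl_def)
  have cl_mod: "n \<in> cl r m \<longleftrightarrow> n mod (int p ^ r) = m mod (int p ^ r)" for m n
    by (simp add: cl_def mod_eq_dvd_iff)
  define B where "B = {0..<int p ^ r}"
  have pr: "int p ^ r > 0" using p(1) by simp
  have rep: "\<exists>a\<in>B. n \<in> cl r a" for n
    using pr by (intro bexI[of _ "n mod (int p ^ r)"]) (auto simp: B_def cl_mod)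
  \<comment> \<open>The classes that lie in S up to finite sets; by uniformity each remaining class
    meets S in a finite set.\<close>
  define A where "A = {a\<in>B. finite (cl r a - S)}"
  have finB: "finite B" by (simp add: B_def)
  then have A: "finite A" by (simp add: A_def)
  have "S - (\<Union>a\<in>A. cl r a) \<subseteq> (\<Union>a\<in>B - A. cl r a \<inter> S)" using rep by blast
  moreover have "finite (\<Union>a\<in>B - A. cl r a \<inter> S)"
    using r finB by (intro finite_UN_I) (auto simp: A_def unif_def)
  ultimately have 1: "finite (S - (\<Union>a\<in>A. cl r a))" by (rule finite_subset)
  have "(\<Union>a\<in>A. cl r a) - S = (\<Union>a\<in>A. cl r a - S)" by blast
  moreover have "finite (\<Union>a\<in>A. cl r a - S)" using A by (intro finite_UN_I) (auto simp: A_def)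
  ultimately have 2: "finite ((\<Union>a\<in>A. cl r a) - S)" by simp
  have eq: "(\<Union>a\<in>A. cl r a) = {n. \<exists>a\<in>A. n mod (int p ^ r) = a mod (int p ^ r)}"
    by (auto simp: cl_mod)
  show ?thesis
    using A 1 2 unfolding S_def eq by - (rule exI[of _ r], rule exI[of _ A], intro conjI)
qed

theorem theoremA1:
  fixes v :: "'k::field_char_0 \<Rightarrow> real"
    and p d :: nat
    and R :: "'k set"
    and M :: "('k tate, 'm) module"
  assumes "prime p"
    and "nonarch_abs v"
    and "complete_wrt v"
    and "v (of_nat p) = 1 / real p"
    and "is_subring R" and "R \<subseteq> val_ring v"
    and "fin_gen_module (tate_ring v d) M"
  shows "rel_open v R {c\<in>R. specializes_to_zero d M c}
       \<and> (rel_compact v R \<longrightarrow>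
            (\<exists>\<epsilon>>0. \<exists>C\<subseteq>R.
               finite ({c\<in>R. specializes_to_zero d M c} - (\<Union>a\<in>C. rel_ball v R a \<epsilon>)) \<and>
               finite ((\<Union>a\<in>C. rel_ball v R a \<epsilon>) - {c\<in>R. specializes_to_zero d M c})))
       \<and> (\<exists>r::nat. \<exists>A::int set. finite A \<and>
            finite ({n::int. specializes_to_zero d M (of_int n)}
                    - {n. \<exists>a\<in>A. n mod (int p ^ r) = a mod (int p ^ r)}) \<and>
            finite ({n. \<exists>a\<in>A. n mod (int p ^ r) = a mod (int p ^ r)}
                    - {n::int. specializes_to_zero d M (of_int n)}))"
proof -
  have "Module.module (tate_ring v d) M" using assms(7) by (simp add: fin_gen_module_def)
  then interpret tate_module v d M
    using assms(2,3)
    by (intro tate_module.intro complete_nonarch_field.intro nonarch_field.intro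
        complete_nonarch_field_axioms.intro tate_module_axioms.intro)
  note iff = specializes_to_zero_iff[OF assms(7)]
  \<comment> \<open>Stated on the whole valuation ring: the assertion about integers needs it at
    p-adic limits, which may lie outside R.\<close>
  have local: "\<exists>\<epsilon>>0. (\<forall>c. c \<noteq> a \<longrightarrow> v (c - a) \<le> \<epsilon> \<longrightarrow> specializes_to_zero d M c) \<or>
      (\<forall>c. v (c - a) \<le> \<epsilon> \<longrightarrow> \<not> specializes_to_zero d M c)" if "v a \<le> 1" for a
    unfolding iff using trivial_at_near[OF is_ideal_annihilator that] .
  have "\<exists>\<delta>>0. \<forall>c'\<in>R. v (c' - c) < \<delta> \<longrightarrow> c' \<in> {c\<in>R. specializes_to_zero d M c}"
    if "c \<in> {c\<in>R. specializes_to_zero d M c}" for c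
    using trivial_at_open[OF is_ideal_annihilator, of c] that unfolding iff by blast
  then have "rel_open v R {c\<in>R. specializes_to_zero d M c}"
    unfolding rel_open_def by blast
  moreover have "\<exists>\<epsilon>>0. \<exists>C\<subseteq>R.
      finite ({c\<in>R. specializes_to_zero d M c} - (\<Union>a\<in>C. rel_ball v R a \<epsilon>)) \<and>
      finite ((\<Union>a\<in>C. rel_ball v R a \<epsilon>) - {c\<in>R. specializes_to_zero d M c})" if "rel_compact v R"
    using that by (rule rel_compact_uniform) (use assms(6) local in \<open>auto simp: val_ring_def\<close>)
  moreover have "inj (of_int :: int \<Rightarrow> 'k)" by (simp add: inj_on_def)
  note integer_uniform[OF this prime_gt_1_nat[OF assms(1)] assms(4), of "specializes_to_zero d M", OF local]
  ultimately show ?thesis by blast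
qed

end
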